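(* Let $\mathbb{P}_{\Delta}$ be a complete simplicial toric variety of dimension $n$, with homogeneous coordinates $z_1,\ldots,z_{n+r}$, where $r$ is the rank of the Weil divisor class group $\mathcal{A}_{n-1}(\mathbb{P}_{\Delta})$. Let $\mathcal{F}$ be a one-dimensional holomorphic foliation on $\mathbb{P}_{\Delta}$ and let $X$ be a quasi-homogeneous vector field which defines $\mathcal{F}$ in homogeneous coordinates. Let $V=\{f=0\}\subset\mathbb{P}_{\Delta}$ be a strongly quasi-smooth hypersurface invariant by $\mathcal{F}$. Then, for each $1\leq k\leq r$ such that $(\deg P)_k\geq 0$ for all (nonzero quasi-homogeneous) $P\in \mathrm{S}=\mathbb{C}[z_1,\dots,z_{n+r}]$, $$\deg(V)_k \leq \deg(\mathcal{F})_k + \max_{1\leq i<j\leq n+r} \big\{\deg(z_i)_k + \deg(z_j)_k\big\}.$$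
   Context: Toric setting: $\Delta$ is a complete simplicial fan in $N\simeq\mathbb{Z}^n$ with rays $\rho_1,\dots,\rho_{n+r}$, whose primitive generators are $n_{\rho_1},\dots,n_{\rho_{n+r}}$; $M=\mathrm{Hom}(N,\mathbb{Z})$; $D_i$ is the torus-invariant Weil divisor of $\rho_i$. The class group $\mathcal{A}_{n-1}(\mathbb{P}_{\Delta})=\mathbb{Z}^{n+r}/\{(\langle m,n_{\rho_i}\rangle)_i: m\in M\}$ has rank $r$. The homogeneous coordinate ring is $\mathrm{S}=\mathbb{C}[z_1,\dots,z_{n+r}]$, graded by $\mathcal{A}_{n-1}(\mathbb{P}_{\Delta})$ with $\deg(z_i)=[D_i]$; $\mathrm{S}_\alpha$ is the graded piece of degree $\alpha$, and its elements are called quasi-homogeneous of degree $\alpha$. Let $G=\mathrm{Hom}_{\mathbb{Z}}(\mathcal{A}_{n-1}(\mathbb{P}_{\Delta}),\mathbb{C}^* )$, acting on $\mathbb{C}^{n+r}$ by $g\cdot(t_i)=(g([D_i])t_i)$, and let $\mathcal{Z}\subset\mathbb{C}^{n+r}$ be the common zero set of the monomials $\prod_{\rho_i\notin\sigma(1)}z_i$, $\sigma\in\Delta$, where $\sigma(1)$ is the set of rays of $\sigma$. Then $\mathbb{P}_{\Delta}=(\mathbb{C}^{n+r}\setminus\mathcal{Z})/G$. Fix an isomorphism $\mathcal{A}_{n-1}(\mathbb{P}_{\Delta})\simeq\mathbb{Z}^r\oplus(\text{finite abelian group})$. For $\alpha\in\mathcal{A}_{n-1}(\mathbb{P}_{\Delta})$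 and $1\le k\le r$, $(\alpha)_k\in\mathbb{Z}$ denotes the $k$-th integer coordinate of $\alpha$. Radial vector fields: choose $r$ integer relations, linearly independent over $\mathbb{Z}$, $\sum_{j=1}^{n+r}a_{i,j}n_{\rho_j}=0$ ($i=1,\dots,r$), and put $R_i=\sum_j a_{i,j}z_j\frac{\partial}{\partial z_j}$. Foliations: a one-dimensional holomorphic foliation $\mathcal{F}$ of degree $\deg(\mathcal{F})=[\sum_i d_iD_i]$ is a global section of $\mathcal{T}\mathbb{P}_{\Delta}\otimes\mathcal{O}_{\mathbb{P}_{\Delta}}(\sum_i d_iD_i)$, where $\mathcal{T}\mathbb{P}_{\Delta}$ is the Zariski tangent sheaf, with singular set of codimension at least $2$. Only foliations are considered that are induced by a quasi-homogeneous vector field $X=\sum_{i=1}^{n+r}P_i\frac{\partial}{\partial z_i}$ with $P_i\in\mathrm{S}_{\deg(\mathcal{F})+\deg(z_i)}$; $X$ is determined modulo vector fields $\sum_{i=1}^r g_iR_i$ with $g_i\in\mathrm{S}$, and $\mathrm{Sing}(\mathcal{F})$ is the image in $\mathbb{P}_{\Delta}$ of $\{R_1\wedge\cdots\wedge R_r\wedge X=0\}$ (in particular $X$ is not of the form $\sum_i g_iR_i$). Hypersurfaces: for a nonconstant quasi-homogeneous $f$, $V=\{f=0\}\subset\mathbb{P}_{\Delta}$ has degree $\deg(V)=\deg(f)$. It is strongly quasi-smooth if $\{f=0\}$ is smooth on $\mathbb{C}^{n+r}\setminus\{0\}$, i.e. $f$ and all its partial derivatives have no common zero there. $V$ is invariant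 by $\mathcal{F}$ if $X(f)=g\cdot f$ for some quasi-homogeneous polynomial $g$. *)

theory Defs
  imports
    "HOL-Analysis.Analysis"
    "HOL-Algebra.Coset"
    "HOL-Library.Poly_Mapping"
    "HOL-Library.Extended_Nat"
begin

section \<open>Fans\<close>

text \<open>The lattice \<open>N\<close> is \<open>int ^ 'n\<close>, sitting in \<open>real ^ 'n\<close>.\<close>

definition lattice_vec :: "int ^ 'n \<Rightarrow> real ^ 'n" where
  "lattice_vec v = (\<chi> l. real_of_int (v $ l))"

definition strongly_convex_rational_polyhedral_cone :: "(real ^ 'n) set \<Rightarrow> bool" where
  "strongly_convex_rational_polyhedral_cone \<sigma> \<longleftrightarrow>
     (\<exists>B :: (int ^ 'n) set. finite B \<and> \<sigma> = convex_cone hull (lattice_vec ` B)) \<and>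
     (\<forall>x. x \<in> \<sigma> \<and> - x \<in> \<sigma> \<longrightarrow> x = 0)"

text \<open>\<open>face_of\<close> admits the empty set as a face; the faces of a polyhedral cone in the sense of
  toric geometry are the nonempty ones.\<close>

definition fan :: "(real ^ 'n) set set \<Rightarrow> bool" where
  "fan \<Delta> \<longleftrightarrow> finite \<Delta> \<and> \<Delta> \<noteq> {} \<and>
     (\<forall>\<sigma>\<in>\<Delta>. strongly_convex_rational_polyhedral_cone \<sigma>) \<and>
     (\<forall>\<sigma>\<in>\<Delta>. \<forall>\<tau>. \<tau> face_of \<sigma> \<and> \<tau> \<noteq> {} \<longrightarrow> \<tau> \<in> \<Delta>) \<and>
     (\<forall>\<sigma>\<in>\<Delta>. \<forall>\<tau>\<in>\<Delta>. (\<sigma> \<inter> \<tau>) face_of \<sigma> \<and> (\<sigma> \<inter> \<tau>) face_of \<tau>)"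

definition complete_fan :: "(real ^ 'n) set set \<Rightarrow> bool" where
  "complete_fan \<Delta> \<longleftrightarrow> fan \<Delta> \<and> \<Union>\<Delta> = UNIV"

definition simplicial_fan :: "(real ^ 'n) set set \<Rightarrow> bool" where
  "simplicial_fan \<Delta> \<longleftrightarrow> fan \<Delta> \<and>
     (\<forall>\<sigma>\<in>\<Delta>. \<exists>B \<subseteq> range (lattice_vec :: int ^ 'n \<Rightarrow> real ^ 'n).
        independent B \<and> \<sigma> = convex_cone hull B)"

definition rays :: "(real ^ 'n) set set \<Rightarrow> (real ^ 'n) set set" where
  "rays \<Delta> = {\<rho>\<in>\<Delta>. dim \<rho> = 1}"

definition primitive :: "int ^ 'n \<Rightarrow> bool" where
  "primitive v \<longleftrightarrow> (\<forall>(c::int) w. v = c *s w \<longrightarrow> is_unit c)"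

definition ray_of :: "int ^ 'n \<Rightarrow> (real ^ 'n) set" where
  "ray_of v = convex_cone hull {lattice_vec v}"

text \<open>The rays are indexed by the finite type \<open>'v\<close>, and \<open>u i\<close> is the primitive generator of the
  ray with index \<open>i\<close>.\<close>

definition enumerates_primitive_generators ::
    "(real ^ 'n) set set \<Rightarrow> ('v \<Rightarrow> int ^ 'n) \<Rightarrow> bool" where
  "enumerates_primitive_generators \<Delta> u \<longleftrightarrow>
     (\<forall>i. primitive (u i)) \<and> bij_betw (\<lambda>i. ray_of (u i)) UNIV (rays \<Delta>)"

section \<open>The class group\<close>

definition additive_group :: "'a::ab_group_add monoid" where
  "additive_group = \<lparr>carrier = UNIV, monoid.mult = (+), one = 0\<rparr>"

text \<open>The image of \<open>M = Hom(N, \<int>)\<close> in \<open>\<int>\<^sup>n\<^sup>+\<^sup>r\<close>.\<close>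

definition principal_divisors :: "('v::finite \<Rightarrow> int ^ 'n) \<Rightarrow> (int ^ 'v) set" where
  "principal_divisors u = {(\<chi> i. m (u i)) | m :: int ^ 'n \<Rightarrow> int. Modules.additive m}"

definition class_group :: "('v::finite \<Rightarrow> int ^ 'n) \<Rightarrow> (int ^ 'v) set monoid" where
  "class_group u = additive_group Mod principal_divisors u"

definition divisor_class :: "('v::finite \<Rightarrow> int ^ 'n) \<Rightarrow> int ^ 'v \<Rightarrow> (int ^ 'v) set" where
  "divisor_class u d = principal_divisors u #>\<^bsub>additive_group\<^esub> d"

text \<open>The class \<open>[D\<^sub>i]\<close>.\<close>

definition var_degree :: "('v::finite \<Rightarrow> int ^ 'n) \<Rightarrow> 'v \<Rightarrow> (int ^ 'v) set" where
  "var_degree u i = divisor_class u (axis i 1)"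

definition degree_coord ::
    "((int ^ 'v) set \<Rightarrow> (int ^ 'r) \<times> 't) \<Rightarrow> (int ^ 'v) set \<Rightarrow> 'r \<Rightarrow> int" where
  "degree_coord \<phi> \<alpha> k = fst (\<phi> \<alpha>) $ k"

section \<open>The homogeneous coordinate ring\<close>

type_synonym 'v mpoly = "('v \<Rightarrow>\<^sub>0 nat) \<Rightarrow>\<^sub>0 complex"

definition var :: "'v \<Rightarrow> 'v mpoly" where
  "var i = Poly_Mapping.single (Poly_Mapping.single i 1) 1"

definition eval_mpoly :: "'v::finite mpoly \<Rightarrow> complex ^ 'v \<Rightarrow> complex" where
  "eval_mpoly p x =
     (\<Sum>m\<in>Poly_Mapping.keys p. Poly_Mapping.lookup p m * (\<Prod>i\<in>UNIV. (x $ i) ^ Poly_Mapping.lookup m i))"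

definition pdiff :: "'v \<Rightarrow> 'v mpoly \<Rightarrow> 'v mpoly" where
  "pdiff i p =
     (\<Sum>m\<in>Poly_Mapping.keys p.
        Poly_Mapping.single (m - Poly_Mapping.single i 1)
          (of_nat (Poly_Mapping.lookup m i) * Poly_Mapping.lookup p m))"

definition constant_mpoly :: "'v mpoly \<Rightarrow> bool" where
  "constant_mpoly p \<longleftrightarrow> (\<exists>c. p = Poly_Mapping.single 0 c)"

text \<open>The monomial \<open>\<Prod> z\<^sub>i ^ m\<^sub>i\<close> has degree \<open>\<Sum> m\<^sub>i [D\<^sub>i] = [\<Sum> m\<^sub>i D\<^sub>i]\<close>.
  The zero polynomial lies in every graded piece.\<close>

definition graded_piece :: "('v::finite \<Rightarrow> int ^ 'n) \<Rightarrow> (int ^ 'v) set \<Rightarrow> 'v mpoly set" where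
  "graded_piece u \<alpha> =
     {p. \<forall>m\<in>Poly_Mapping.keys p. divisor_class u (\<chi> i. int (Poly_Mapping.lookup m i)) = \<alpha>}"

definition quasi_homogeneous :: "('v::finite \<Rightarrow> int ^ 'n) \<Rightarrow> 'v mpoly \<Rightarrow> bool" where
  "quasi_homogeneous u p \<longleftrightarrow> (\<exists>\<alpha>\<in>carrier (class_group u). p \<in> graded_piece u \<alpha>)"

section \<open>The toric variety as a quotient\<close>

definition complex_units :: "complex monoid" where
  "complex_units = \<lparr>carrier = - {0}, monoid.mult = (*), one = 1\<rparr>"

definition exceptional_set ::
    "(real ^ 'n) set set \<Rightarrow> ('v::finite \<Rightarrow> int ^ 'n) \<Rightarrow> (complex ^ 'v) set" where
  "exceptional_set \<Delta> u = {x. \<forall>\<sigma>\<in>\<Delta>. (\<Prod>i | \<not> ray_of (u i) face_of \<sigma>. x $ i) = 0}"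

definition torus_orbit :: "('v::finite \<Rightarrow> int ^ 'n) \<Rightarrow> complex ^ 'v \<Rightarrow> (complex ^ 'v) set" where
  "torus_orbit u x =
     {(\<chi> i. g (var_degree u i) * x $ i) | g. g \<in> hom (class_group u) complex_units}"

definition zariski_topology :: "(complex ^ 'v::finite) topology" where
  "zariski_topology = topology_generated_by {{x. eval_mpoly p x \<noteq> 0} | p. True}"

definition toric_variety ::
    "(real ^ 'n) set set \<Rightarrow> ('v::finite \<Rightarrow> int ^ 'n) \<Rightarrow> (complex ^ 'v) set set" where
  "toric_variety \<Delta> u = torus_orbit u ` (- exceptional_set \<Delta> u)"

text \<open>The quotient topology. The generating sets are already closed under finite intersections
  and arbitrary unions.\<close>

definition toric_topology ::
    "(real ^ 'n) set set \<Rightarrow> ('v::finite \<Rightarrow> int ^ 'n) \<Rightarrow> (complex ^ 'v) set topology" where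
  "toric_topology \<Delta> u = topology_generated_by
     {U. U \<subseteq> toric_variety \<Delta> u \<and>
         openin (subtopology zariski_topology (- exceptional_set \<Delta> u))
           {x. x \<notin> exceptional_set \<Delta> u \<and> torus_orbit u x \<in> U}}"

definition irreducible_closed :: "'a topology \<Rightarrow> 'a set \<Rightarrow> bool" where
  "irreducible_closed T Z \<longleftrightarrow> closedin T Z \<and> Z \<noteq> {} \<and>
     (\<forall>A B. closedin T A \<and> closedin T B \<and> Z \<subseteq> A \<union> B \<longrightarrow> Z \<subseteq> A \<or> Z \<subseteq> B)"

text \<open>Krull codimension: the length of the longest chain of irreducible closed sets starting at
  an irreducible closed \<open>Z\<close>, minimised over \<open>Z \<subseteq> Y\<close>. The empty set has codimension \<open>\<infinity>\<close>.\<close>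

definition codimension :: "'a topology \<Rightarrow> 'a set \<Rightarrow> enat" where
  "codimension T Y =
     (INF Z\<in>{Z. irreducible_closed T Z \<and> Z \<subseteq> Y}.
        SUP l\<in>{l. \<exists>C :: nat \<Rightarrow> 'a set. C 0 = Z \<and>
                 (\<forall>i\<le>l. irreducible_closed T (C i)) \<and> (\<forall>i<l. C i \<subset> C (Suc i))}.
          enat l)"

section \<open>Vector fields and foliations\<close>

text \<open>The vector field \<open>\<Sum> P\<^sub>i \<partial>/\<partial>z\<^sub>i\<close> is represented by the vector \<open>P\<close>.\<close>

type_synonym 'v vfield = "'v mpoly ^ 'v"

definition apply_vfield :: "'v::finite vfield \<Rightarrow> 'v mpoly \<Rightarrow> 'v mpoly" where
  "apply_vfield X f = (\<Sum>i\<in>UNIV. X $ i * pdiff i f)"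

definition eval_vfield :: "'v::finite vfield \<Rightarrow> complex ^ 'v \<Rightarrow> complex ^ 'v" where
  "eval_vfield X x = (\<chi> i. eval_mpoly (X $ i) x)"

definition quasi_homogeneous_vfield ::
    "('v::finite \<Rightarrow> int ^ 'n) \<Rightarrow> (int ^ 'v) set \<Rightarrow> 'v vfield \<Rightarrow> bool" where
  "quasi_homogeneous_vfield u \<alpha> X \<longleftrightarrow>
     (\<forall>i. X $ i \<in> graded_piece u (\<alpha> \<otimes>\<^bsub>class_group u\<^esub> var_degree u i))"

definition independent_relations :: "('v::finite \<Rightarrow> int ^ 'n) \<Rightarrow> ('r::finite \<Rightarrow> int ^ 'v) \<Rightarrow> bool" where
  "independent_relations u a \<longleftrightarrow>
     (\<forall>i. (\<Sum>j\<in>UNIV. a i $ j *s u j) = 0) \<and>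
     (\<forall>c :: 'r \<Rightarrow> int. (\<Sum>i\<in>UNIV. c i *s a i) = 0 \<longrightarrow> (\<forall>i. c i = 0))"

definition radial_vfield :: "('r \<Rightarrow> int ^ 'v) \<Rightarrow> 'r \<Rightarrow> 'v::finite vfield" where
  "radial_vfield a i = (\<chi> j. of_int (a i $ j) * var j)"

text \<open>The multivector \<open>w\<^sub>1 \<and> \<dots> \<and> w\<^sub>k\<close> through its components: the one indexed by
  \<open>(J\<^sub>1,\<dots>,J\<^sub>k)\<close> is the minor of the columns \<open>J\<^sub>1,\<dots>,J\<^sub>k\<close>.\<close>

definition wedge :: "('k::finite \<Rightarrow> complex ^ 'v) \<Rightarrow> ('k \<Rightarrow> 'v) \<Rightarrow> complex" where
  "wedge w J = det (\<chi> s t. w s $ J t)"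

text \<open>The locus \<open>R\<^sub>1 \<and> \<dots> \<and> R\<^sub>r \<and> X = 0\<close>; the index \<open>None\<close> stands for \<open>X\<close>.\<close>

definition radial_degeneracy_locus ::
    "('r::finite \<Rightarrow> int ^ 'v) \<Rightarrow> 'v::finite vfield \<Rightarrow> (complex ^ 'v) set" where
  "radial_degeneracy_locus a X =
     {x. wedge (\<lambda>s. eval_vfield (case s of None \<Rightarrow> X | Some i \<Rightarrow> radial_vfield a i) x) = (\<lambda>J. 0)}"

definition singular_set ::
    "(real ^ 'n) set set \<Rightarrow> ('v::finite \<Rightarrow> int ^ 'n) \<Rightarrow> ('r::finite \<Rightarrow> int ^ 'v) \<Rightarrow> 'v vfield
      \<Rightarrow> (complex ^ 'v) set set" where
  "singular_set \<Delta> u a X = torus_orbit u ` (radial_degeneracy_locus a X - exceptional_set \<Delta> u)"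

text \<open>A foliation of degree \<open>\<alpha>\<close> is identified with the set of all quasi-homogeneous vector fields
  that define it, i.e. with a class of such fields modulo the radial ones.\<close>

definition foliation ::
    "(real ^ 'n) set set \<Rightarrow> ('v::finite \<Rightarrow> int ^ 'n) \<Rightarrow> ('r::finite \<Rightarrow> int ^ 'v) \<Rightarrow> (int ^ 'v) set
      \<Rightarrow> 'v vfield set \<Rightarrow> bool" where
  "foliation \<Delta> u a \<alpha> \<F> \<longleftrightarrow> \<alpha> \<in> carrier (class_group u) \<and>
     (\<exists>X. quasi_homogeneous_vfield u \<alpha> X \<and>
        codimension (toric_topology \<Delta> u) (singular_set \<Delta> u a X) \<ge> 2 \<and>
        \<F> = {Y. quasi_homogeneous_vfield u \<alpha> Y \<and>
                 (\<exists>g :: 'r \<Rightarrow> 'v mpoly. Y = X + (\<Sum>i\<in>UNIV. g i *s radial_vfield a i))})"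

section \<open>Hypersurfaces\<close>

definition strongly_quasi_smooth :: "'v::finite mpoly \<Rightarrow> bool" where
  "strongly_quasi_smooth f \<longleftrightarrow>
     (\<forall>x. x \<noteq> 0 \<longrightarrow> \<not> (eval_mpoly f x = 0 \<and> (\<forall>i. eval_mpoly (pdiff i f) x = 0)))"

definition invariant_hypersurface ::
    "('v::finite \<Rightarrow> int ^ 'n) \<Rightarrow> 'v vfield \<Rightarrow> 'v mpoly \<Rightarrow> bool" where
  "invariant_hypersurface u X f \<longleftrightarrow> (\<exists>g. quasi_homogeneous u g \<and> apply_vfield X f = g * f)"

end

theory Submission
  imports
    Defs
    "HOL-Computational_Algebra.Fundamental_Theorem_Algebra"
begin

text \<open>
  Fix the coordinate \<open>k\<close> and give \<open>z\<^sub>i\<close> the integer weight \<open>w\<^sub>i = deg(z\<^sub>i)\<^sub>k \<ge> 0\<close>. A quasi-homogeneous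
  polynomial is then weighted homogeneous; write \<open>d\<close> for the weight of \<open>f\<close> and \<open>e\<close> for that of the
  foliation, so that the coefficient \<open>P\<^sub>i\<close> of \<open>X\<close> has weight \<open>e + w\<^sub>i\<close>. Suppose the bound fails, that is
  \<open>e + w\<^sub>i + w\<^sub>j < d\<close> whenever \<open>i \<noteq> j\<close>. The contradiction comes from showing that \<open>X\<close> is radial,
  which is clear for \<open>X = 0\<close>.

  If \<open>P\<^sub>i \<noteq> 0\<close> for some \<open>i\<close>, then \<open>e + w\<^sub>i \<ge> 0\<close> and hence \<open>d > 0\<close>. The Euler identity
  \<open>\<Sum> w\<^sub>i z\<^sub>i \<partial>\<^sub>i f = d f\<close> turns the invariance \<open>X(f) = g f\<close> into a relation \<open>\<Sum> Q\<^sub>i \<partial>\<^sub>i f = 0\<close> with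
  \<open>Q\<^sub>i = d P\<^sub>i - w\<^sub>i z\<^sub>i g\<close>. By the Euler identity again, a common zero of the partial derivatives is a
  zero of \<open>f\<close>, so strong quasi-smoothness leaves only the origin, and by the Nullstellensatz
  (\<open>hilbert_nullstellensatz\<close>) the ideal of the partial derivatives contains a power of every \<open>z\<^sub>i\<close>.
  These powers form a regular sequence as long as the list of partial derivatives, which makes the
  first Koszul homology of the partial derivatives vanish. In particular
  \<open>Q\<^sub>i\<close> lies in the ideal of the \<open>\<partial>\<^sub>j f\<close> with \<open>j \<noteq> i\<close> (\<open>syzygy_coefficient_in_other_ideal\<close>). All of these
  have weight \<open>d - w\<^sub>j > e + w\<^sub>i\<close>, and multiplication never lowers weights, so \<open>Q\<^sub>i\<close> has no part of weight
  \<open>e + w\<^sub>i\<close>. Hence \<open>d P\<^sub>i = w\<^sub>i z\<^sub>i h\<close>, where \<open>h\<close> is the part of \<open>g\<close> of weight \<open>e\<close>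
  (\<open>invariant_field_proportional_to_radial\<close>).

  So \<open>X\<close> is everywhere a multiple of \<open>\<Sum> w\<^sub>i z\<^sub>i \<partial>/\<partial>z\<^sub>i\<close>. The \<open>r\<close> coordinate functions of the class group
  give \<open>r\<close> such fields, and they span all relations among the primitive generators
  (\<open>relation_in_span_of_degrees\<close>). Thus \<open>R\<^sub>1, \<dots>, R\<^sub>r, X\<close> are \<open>r + 1\<close> vectors in a space spanned by \<open>r\<close>
  vectors, their wedge product vanishes identically, and every point is singular. But the toric
  variety is irreducible, so as a subset of itself it has codimension \<open>0\<close>, whereas the singular set of a
  foliation has codimension at least \<open>2\<close>.
\<close>

section \<open>Koszul chains over a commutative ring\<close>

interpretation ring_module: module "(*) :: 'a \<Rightarrow> 'a \<Rightarrow> 'a::comm_ring_1"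
  by unfold_locales (simp_all add: algebra_simps)

\<comment> \<open>For the ring over itself this rule reassociates products to the left, against \<open>mult.assoc\<close>.\<close>
declare ring_module.scale_scale [simp del]

abbreviation ideal_gen :: "'a set \<Rightarrow> 'a::comm_ring_1 set" where
  "ideal_gen \<equiv> ring_module.span"

text \<open>A Koszul chain with coefficients in a ring is a function \<open>c\<close> on subsets of the index set, \<open>c B\<close> being
  the coefficient of the ordered wedge product of the basis vectors indexed by \<open>B\<close>. Chains of all
  degrees are kept together; statements about degree \<open>m\<close> look at \<open>B\<close> with \<open>card B = m\<close> only. The sign
  is that of sorting \<open>j\<close>, placed in front of \<open>B\<close>, into its position.\<close>

definition koszul_sign :: "'v::linorder \<Rightarrow> 'v set \<Rightarrow> 'a::comm_ring_1" where
  "koszul_sign j B = (-1) ^ card {b\<in>B. b < j}"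

definition koszul_diff :: "('v \<Rightarrow> 'a) \<Rightarrow> ('v set \<Rightarrow> 'a) \<Rightarrow> ('v::{finite,linorder}) set \<Rightarrow> 'a::comm_ring_1" where
  "koszul_diff p c B = (\<Sum>j\<in>-B. koszul_sign j B * p j * c (insert j B))"

definition koszul_wedge :: "('v \<Rightarrow> 'a) \<Rightarrow> ('v set \<Rightarrow> 'a) \<Rightarrow> ('v::{finite,linorder}) set \<Rightarrow> 'a::comm_ring_1" where
  "koszul_wedge \<eta> c B = (\<Sum>j\<in>B. koszul_sign j (B - {j}) * \<eta> j * c (B - {j}))"

lemma koszul_sign_square [simp]: "koszul_sign j B * koszul_sign j B = 1"
  by (simp add: koszul_sign_def flip: power_mult_distrib)

lemma koszul_sign_insert:
  fixes B :: "'v::{finite,linorder} set"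
  assumes "k \<notin> B"
  shows "koszul_sign j (insert k B) = (if k < j then - koszul_sign j B else koszul_sign j B)"
proof -
  have "{b \<in> insert k B. b < j} = (if k < j then insert k {b\<in>B. b < j} else {b\<in>B. b < j})"
    by auto
  then show ?thesis
    using assms by (simp add: koszul_sign_def)
qed

lemma koszul_sign_swap:
  fixes B :: "'v::{finite,linorder} set"
  assumes "j \<noteq> k" "j \<notin> B" "k \<notin> B"
  shows "koszul_sign j (insert k B) * koszul_sign k (insert j B) = - (koszul_sign j B * koszul_sign k B)"
  using assms by (auto simp: koszul_sign_insert)

text \<open>Removing \<open>j\<close> and \<open>k\<close> in either order produces the same term with opposite signs.\<close>

lemma koszul_diff_diff:
  fixes p :: "'v::{finite,linorder} \<Rightarrow> 'a::comm_ring_1"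
  shows "koszul_diff p (koszul_diff p c) B = 0"
proof -
  define F where "F j k = koszul_sign j B * p j * (koszul_sign k (insert j B) * p k * c (insert k (insert j B)))"
    for j k
  have anti: "F k j = - F j k" if "j < k" "j \<in> - B" "k \<in> - B" for j k
  proof -
    have "koszul_sign j (insert k B) = (koszul_sign j B :: 'a)" "koszul_sign k (insert j B) = - (koszul_sign k B :: 'a)"
      using that by (auto simp: koszul_sign_insert)
    moreover have "insert j (insert k B) = insert k (insert j B)" by auto
    ultimately show ?thesis by (simp only: F_def mult_minus_left mult_minus_right minus_minus mult_ac)
  qed
  let ?P = "SIGMA j:-B. - insert j B"
  let ?L = "{(j, k). j \<in> - B \<and> k \<in> - B \<and> j < k}"
  let ?G = "{(j, k). j \<in> - B \<and> k \<in> - B \<and> k < j}"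
  have "koszul_diff p (koszul_diff p c) B = (\<Sum>j\<in>-B. \<Sum>k\<in>- insert j B. F j k)"
    by (simp add: koszul_diff_def F_def sum_distrib_left)
  also have "\<dots> = (\<Sum>(j, k)\<in>?P. F j k)"
    by (subst sum.Sigma) auto
  also have "?P = ?L \<union> ?G" by auto
  also have "(\<Sum>(j, k)\<in>?L \<union> ?G. F j k) = (\<Sum>(j, k)\<in>?L. F j k) + (\<Sum>(j, k)\<in>?G. F j k)"
    by (intro sum.union_disjoint) auto
  also have "(\<Sum>(j, k)\<in>?G. F j k) = (\<Sum>(j, k)\<in>?L. F k j)"
    by (rule sum.reindex_bij_witness[of _ prod.swap prod.swap]) auto
  also have "\<dots> = (\<Sum>(j, k)\<in>?L. - F j k)"
    by (intro sum.cong) (auto simp: anti)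
  also have "\<dots> = - (\<Sum>(j, k)\<in>?L. F j k)"
    by (simp add: sum_negf case_prod_unfold)
  finally show ?thesis by simp
qed

lemma koszul_diff_linear:
  "koszul_diff p (\<lambda>B. f B + y * g B + h B) B = koszul_diff p f B + y * koszul_diff p g B + koszul_diff p h B"
  unfolding koszul_diff_def sum_distrib_left sum.distrib[symmetric]
  by (intro sum.cong refl) (simp only: distrib_left mult.assoc mult.left_commute[of y])

text \<open>Wedging with \<open>\<eta>\<close> is a homotopy between zero and multiplication by \<open>\<Sum> p\<^sub>j \<eta>\<^sub>j\<close>. Hence every element of
  the ideal generated by the \<open>p\<^sub>j\<close> annihilates Koszul homology.\<close>

lemma koszul_homotopy:
  fixes p \<eta> :: "'v::{finite,linorder} \<Rightarrow> 'a::comm_ring_1"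
  shows "koszul_diff p (koszul_wedge \<eta> c) B + koszul_wedge \<eta> (koszul_diff p c) B
    = (\<Sum>j\<in>UNIV. p j * \<eta> j) * c B"
proof -
  define H where "H j k = p j * \<eta> k * c (insert j (B - {k}))" for j k
  have sign_cancel: "koszul_sign j D * (koszul_sign j D * a) = a" for j D and a :: 'a
    by (simp flip: mult.assoc)
  have "koszul_diff p (koszul_wedge \<eta> c) B =
      (\<Sum>j\<in>-B. p j * \<eta> j * c B + (\<Sum>k\<in>B. koszul_sign j B * koszul_sign k (insert j (B - {k})) * H j k))"
    unfolding koszul_diff_def
  proof (intro sum.cong refl)
    fix j assume j: "j \<in> - B"
    have "koszul_wedge \<eta> c (insert j B) = koszul_sign j B * \<eta> j * c B
        + (\<Sum>k\<in>B. koszul_sign k (insert j (B - {k})) * \<eta> k * c (insert j (B - {k})))"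
      using j unfolding koszul_wedge_def
      by (subst sum.insert) (auto simp: insert_Diff_if intro!: sum.cong)
    then show "koszul_sign j B * p j * koszul_wedge \<eta> c (insert j B) = p j * \<eta> j * c B
        + (\<Sum>k\<in>B. koszul_sign j B * koszul_sign k (insert j (B - {k})) * H j k)"
      by (simp only: distrib_left sum_distrib_left H_def sign_cancel mult.assoc mult.left_commute[of "p j"])
  qed
  moreover have "koszul_wedge \<eta> (koszul_diff p c) B =
      (\<Sum>k\<in>B. p k * \<eta> k * c B + (\<Sum>j\<in>-B. koszul_sign k (B - {k}) * koszul_sign j (B - {k}) * H j k))"
    unfolding koszul_wedge_def
  proof (intro sum.cong refl)
    fix k assume k: "k \<in> B"
    have "- (B - {k}) = insert k (- B)" using k by auto
    then have "koszul_diff p c (B - {k}) = koszul_sign k (B - {k}) * p k * c B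
        + (\<Sum>j\<in>-B. koszul_sign j (B - {k}) * p j * c (insert j (B - {k})))"
      using k unfolding koszul_diff_def by (simp add: insert_absorb)
    then show "koszul_sign k (B - {k}) * \<eta> k * koszul_diff p c (B - {k}) = p k * \<eta> k * c B
        + (\<Sum>j\<in>-B. koszul_sign k (B - {k}) * koszul_sign j (B - {k}) * H j k)"
      by (simp only: distrib_left sum_distrib_left H_def sign_cancel mult.assoc mult.left_commute[of "\<eta> k"])
  qed
  moreover have "(\<Sum>j\<in>-B. \<Sum>k\<in>B. koszul_sign j B * koszul_sign k (insert j (B - {k})) * H j k)
     = - (\<Sum>k\<in>B. \<Sum>j\<in>-B. koszul_sign k (B - {k}) * koszul_sign j (B - {k}) * H j k)"
  proof -
    have "koszul_sign j B * koszul_sign k (insert j (B - {k}))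
        = - (koszul_sign k (B - {k}) * koszul_sign j (B - {k}) :: 'a)" if "j \<in> - B" "k \<in> B" for j k
      using that koszul_sign_swap[of j k "B - {k}", where 'a = 'a] by (auto simp: insert_absorb mult_ac)
    then have "(\<Sum>j\<in>-B. \<Sum>k\<in>B. koszul_sign j B * koszul_sign k (insert j (B - {k})) * H j k)
        = (\<Sum>j\<in>-B. \<Sum>k\<in>B. - (koszul_sign k (B - {k}) * koszul_sign j (B - {k}) * H j k))"
      by (intro sum.cong refl) simp
    then show ?thesis
      by (simp add: sum_negf sum.swap[of _ B "-B"])
  qed
  ultimately have "koszul_diff p (koszul_wedge \<eta> c) B + koszul_wedge \<eta> (koszul_diff p c) B
      = (\<Sum>j\<in>-B. p j * \<eta> j * c B) + (\<Sum>j\<in>B. p j * \<eta> j * c B)"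
    by (simp add: sum.distrib)
  also have "\<dots> = (\<Sum>j\<in>-B \<union> B. p j * \<eta> j * c B)"
    by (intro sum.union_disjoint[symmetric]) auto
  finally show ?thesis by (simp add: sum_distrib_right Compl_partition2)
qed

lemma ideal_gen_range_finite:
  fixes p :: "'v::finite \<Rightarrow> 'a::comm_ring_1"
  assumes "y \<in> ideal_gen (range p)"
  obtains \<eta> where "y = (\<Sum>j\<in>UNIV. p j * \<eta> j)"
proof -
  have "\<exists>\<eta>. y = (\<Sum>j\<in>UNIV. p j * \<eta> j)"
    using assms
  proof (induction rule: ring_module.span_induct_alt)
    case base
    show ?case by (intro exI[of _ "\<lambda>_. 0"]) simp
  next
    case (step c x y)
    then obtain i \<eta> where "x = p i" and y: "y = (\<Sum>j\<in>UNIV. p j * \<eta> j)" by auto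
    moreover have "(\<Sum>j\<in>UNIV. p j * (\<eta> j + (if j = i then c else 0))) = y + p i * c"
      by (simp only: y distrib_left sum.distrib) (simp add: if_distrib cong: if_cong)
    ultimately have "c * x + y = (\<Sum>j\<in>UNIV. p j * (\<eta> j + (if j = i then c else 0)))"
      by (simp add: mult.commute add.commute)
    then show ?case by (intro exI[of _ "\<lambda>j. \<eta> j + (if j = i then c else 0)"])
  qed
  then show ?thesis using that by blast
qed

text \<open>Let \<open>x\<close> be a regular sequence, in every order, inside the ideal generated by the \<open>p\<^sub>j\<close>, and as long
  as the family \<open>p\<close>. Modulo the \<open>x\<^sub>i\<close> with \<open>i \<in> A\<close>, the Koszul complex of \<open>p\<close> is exact in all degrees
  above \<open>card A\<close>. The proof goes from large \<open>A\<close> to small: for \<open>i \<notin> A\<close>, multiplication by \<open>x\<^sub>i\<close> kills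
  homology and is injective on the quotient, so the degree \<open>m\<close> homology modulo \<open>A\<close> is an image of the
  degree \<open>m + 1\<close> homology modulo \<open>A \<union> {i}\<close>. Once \<open>A\<close> is the whole index set, there are no chains
  of degree above \<open>card A\<close>.\<close>

lemma koszul_exact_modulo:
  fixes p x :: "'v::{finite,linorder} \<Rightarrow> 'a::comm_ring_1"
  assumes reg: "\<And>A i y. i \<notin> A \<Longrightarrow> x i * y \<in> ideal_gen (x ` A) \<Longrightarrow> y \<in> ideal_gen (x ` A)"
    and mem: "\<And>i. x i \<in> ideal_gen (range p)"
    and cycle: "\<And>B. Suc (card B) = m \<Longrightarrow> koszul_diff p c B \<in> ideal_gen (x ` A)"
    and m: "card A < m"
  shows "\<exists>e. \<forall>B. card B = m \<longrightarrow> c B - koszul_diff p e B \<in> ideal_gen (x ` A)"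
  using cycle m
proof (induction "card (- A)" arbitrary: A c m)
  case 0
  then have "A = UNIV" by (metis card_0_eq finite_code double_compl Compl_empty_eq)
  then have "card B \<noteq> m" for B :: "'v set"
    using 0 card_mono[of UNIV B] by auto
  then show ?case by blast
next
  case (Suc n)
  then obtain i where i: "i \<notin> A"
    by (metis ComplD card_eq_0_iff ex_in_conv nat.distinct(1))
  let ?A = "insert i A" and ?I = "ideal_gen (x ` A)"
  obtain \<eta> where \<eta>: "x i = (\<Sum>j\<in>UNIV. p j * \<eta> j)"
    using ideal_gen_range_finite[OF mem] by blast
  \<comment> \<open>Lift the cycle \<open>c\<close> to \<open>\<eta> \<and> c\<close>: its differential is \<open>x\<^sub>i c\<close> up to terms in the ideal of \<open>A\<close>.\<close>
  have homotopy: "koszul_diff p (koszul_wedge \<eta> c) B = x i * c B - koszul_wedge \<eta> (koszul_diff p c) B" for B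
    using koszul_homotopy[of p \<eta> c B] by (simp add: \<eta> algebra_simps)
  have wedge_cycle: "koszul_wedge \<eta> (koszul_diff p c) B \<in> ?I" if "card B = m" for B
    unfolding koszul_wedge_def
  proof (intro ring_module.span_sum ring_module.span_scale)
    fix j assume "j \<in> B"
    then have "Suc (card (B - {j})) = m" using that by (metis card.remove finite_code)
    then show "koszul_diff p c (B - {j}) \<in> ?I" by (rule Suc.prems)
  qed
  have "\<exists>e. \<forall>B. card B = Suc m \<longrightarrow> koszul_wedge \<eta> c B - koszul_diff p e B \<in> ideal_gen (x ` ?A)"
  proof (rule Suc.hyps(1))
    show "n = card (- ?A)"
      using Suc.hyps(2) i by (simp add: Compl_insert)
    show "card ?A < Suc m" using i Suc.prems(2) by simp
    fix B :: "'v set" assume "Suc (card B) = Suc m"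
    then have "koszul_diff p (koszul_wedge \<eta> c) B - c B * x i \<in> ?I"
      using wedge_cycle[of B] by (simp add: homotopy mult.commute ring_module.span_neg)
    then show "koszul_diff p (koszul_wedge \<eta> c) B \<in> ideal_gen (x ` ?A)"
      by (auto simp: ring_module.span_breakdown_eq)
  qed
  then obtain e where e: "\<And>B. card B = Suc m \<Longrightarrow> \<exists>y. koszul_wedge \<eta> c B - koszul_diff p e B - y * x i \<in> ?I"
    by (auto simp: ring_module.span_breakdown_eq)
  define e' where "e' B = (SOME y. koszul_wedge \<eta> c B - koszul_diff p e B - y * x i \<in> ?I)" for B
  define t where "t B = koszul_wedge \<eta> c B - koszul_diff p e B - e' B * x i" for B
  have t: "t B \<in> ?I" if "card B = Suc m" for B
    unfolding t_def e'_def using e[OF that] by (rule someI_ex)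
  \<comment> \<open>The part of \<open>\<eta> \<and> c\<close> divisible by \<open>x\<^sub>i\<close> is the required preimage, once \<open>x\<^sub>i\<close> is cancelled.\<close>
  have "c B - koszul_diff p e' B \<in> ?I" if B: "card B = m" for B
  proof (rule reg[OF i])
    have wedge: "koszul_wedge \<eta> c = (\<lambda>B. koszul_diff p e B + x i * e' B + t B)"
      by (simp add: t_def mult.commute)
    have "koszul_diff p (koszul_wedge \<eta> c) B
        = koszul_diff p (koszul_diff p e) B + x i * koszul_diff p e' B + koszul_diff p t B"
      unfolding wedge by (rule koszul_diff_linear)
    then have "x i * (c B - koszul_diff p e' B) = koszul_wedge \<eta> (koszul_diff p c) B + koszul_diff p t B"
      by (simp add: koszul_diff_diff homotopy algebra_simps)
    moreover have "koszul_diff p t B \<in> ?I"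
      unfolding koszul_diff_def using B
      by (intro ring_module.span_sum ring_module.span_scale t) simp
    ultimately show "x i * (c B - koszul_diff p e' B) \<in> ?I"
      using wedge_cycle[OF B] by (simp add: ring_module.span_add)
  qed
  then show ?case by blast
qed

text \<open>This is exactness in degree one modulo nothing: a syzygy of \<open>p\<close> is a combination of the trivial
  ones \<open>p\<^sub>j p\<^sub>i - p\<^sub>i p\<^sub>j = 0\<close>, and no trivial syzygy involves \<open>p\<^sub>i\<close> itself in its \<open>i\<close>-th coefficient.\<close>

lemma syzygy_coefficient_in_other_ideal:
  fixes p x q :: "'v::{finite,linorder} \<Rightarrow> 'a::comm_ring_1"
  assumes reg: "\<And>A i y. i \<notin> A \<Longrightarrow> x i * y \<in> ideal_gen (x ` A) \<Longrightarrow> y \<in> ideal_gen (x ` A)"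
    and mem: "\<And>i. x i \<in> ideal_gen (range p)"
    and syz: "(\<Sum>j\<in>UNIV. q j * p j) = 0"
  obtains b where "\<And>i. q i = (\<Sum>j\<in>-{i}. b i j * p j)"
proof -
  define c where "c B = (\<Sum>j\<in>B. q j)" for B
  have "\<exists>e. \<forall>B. card B = 1 \<longrightarrow> c B - koszul_diff p e B \<in> ideal_gen (x ` {})"
  proof (rule koszul_exact_modulo[OF reg mem])
    fix B :: "'v set" assume "Suc (card B) = 1"
    then have "B = {}" by simp
    then show "koszul_diff p c B \<in> ideal_gen (x ` {})"
      using syz by (simp add: koszul_diff_def c_def koszul_sign_def mult.commute)
  qed simp_all
  then obtain e where e: "\<And>B. card B = 1 \<Longrightarrow> c B = koszul_diff p e B"
    by (auto simp: ring_module.span_empty)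
  have "q i = (\<Sum>j\<in>-{i}. (koszul_sign j {i} * e {j, i}) * p j)" for i
  proof -
    have "q i = koszul_diff p e {i}"
      using e[of "{i}"] by (simp add: c_def)
    also have "\<dots> = (\<Sum>j\<in>-{i}. (koszul_sign j {i} * e {j, i}) * p j)"
      unfolding koszul_diff_def by (intro sum.cong refl) (simp only: mult.assoc mult.commute[of "p _"])
    finally show ?thesis .
  qed
  then show ?thesis by (rule that)
qed

section \<open>Evaluation of polynomials\<close>

abbreviation const_mpoly :: "complex \<Rightarrow> 'v mpoly" where
  "const_mpoly c \<equiv> Poly_Mapping.single 0 c"

lemma mpoly_eq_sum_monomials:
  fixes p :: "'v mpoly"
  assumes "finite K" "Poly_Mapping.keys p \<subseteq> K"
  shows "p = (\<Sum>m\<in>K. Poly_Mapping.single m (Poly_Mapping.lookup p m))"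
proof (rule poly_mapping_eqI)
  fix n
  have "Poly_Mapping.lookup (\<Sum>m\<in>K. Poly_Mapping.single m (Poly_Mapping.lookup p m)) n
      = (\<Sum>m\<in>K. if m = n then Poly_Mapping.lookup p m else 0)"
    by (simp add: lookup_sum lookup_single when_def)
  then show "Poly_Mapping.lookup p n = Poly_Mapping.lookup (\<Sum>m\<in>K. Poly_Mapping.single m (Poly_Mapping.lookup p m)) n"
    using assms by (auto simp: in_keys_iff)
qed

lemma eval_mpoly_superset:
  fixes p :: "'v::finite mpoly"
  assumes "finite K" "Poly_Mapping.keys p \<subseteq> K"
  shows "eval_mpoly p x = (\<Sum>m\<in>K. Poly_Mapping.lookup p m * (\<Prod>i\<in>UNIV. (x $ i) ^ Poly_Mapping.lookup m i))"
  unfolding eval_mpoly_def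
  by (rule sum.mono_neutral_left) (use assms in \<open>auto simp: in_keys_iff\<close>)

lemma eval_mpoly_add [simp]:
  fixes p q :: "'v::finite mpoly"
  shows "eval_mpoly (p + q) x = eval_mpoly p x + eval_mpoly q x"
proof -
  let ?K = "Poly_Mapping.keys p \<union> Poly_Mapping.keys q"
  show ?thesis
    using keys_add[of p q]
    by (simp add: eval_mpoly_superset[of ?K] lookup_add distrib_right sum.distrib)
qed

lemma eval_mpoly_zero [simp]: "eval_mpoly 0 x = 0"
  by (simp add: eval_mpoly_def)

lemma eval_mpoly_sum [simp]: "eval_mpoly (\<Sum>a\<in>A. p a) x = (\<Sum>a\<in>A. eval_mpoly (p a) x)"
  by (induction A rule: infinite_finite_induct) simp_all

lemma eval_mpoly_single:
  "eval_mpoly (Poly_Mapping.single m c) x = c * (\<Prod>i\<in>UNIV. (x $ i) ^ Poly_Mapping.lookup m i)"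
  by (simp add: eval_mpoly_superset[of "{m}"])

lemma eval_mpoly_const [simp]: "eval_mpoly (const_mpoly c) x = c"
  by (simp add: eval_mpoly_single)

lemma eval_mpoly_mult [simp]:
  fixes p q :: "'v::finite mpoly"
  shows "eval_mpoly (p * q) x = eval_mpoly p x * eval_mpoly q x"
proof -
  let ?P = "Poly_Mapping.keys p" and ?Q = "Poly_Mapping.keys q"
  have "p * q = (\<Sum>m\<in>?P. Poly_Mapping.single m (Poly_Mapping.lookup p m)) *
      (\<Sum>n\<in>?Q. Poly_Mapping.single n (Poly_Mapping.lookup q n))"
    by (simp flip: mpoly_eq_sum_monomials)
  also have "\<dots> = (\<Sum>m\<in>?P. \<Sum>n\<in>?Q. Poly_Mapping.single (m + n) (Poly_Mapping.lookup p m * Poly_Mapping.lookup q n))"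
    by (simp add: sum_product mult_single)
  finally have pq: "p * q = \<dots>" .
  show ?thesis
    unfolding pq eval_mpoly_sum eval_mpoly_single eval_mpoly_def[of p] eval_mpoly_def[of q] sum_product
      lookup_add power_add prod.distrib
    by (intro sum.cong refl) (simp only: mult_ac)
qed

lemma eval_mpoly_of_int [simp]: "eval_mpoly (of_int n) x = of_int n"
  by (simp flip: single_of_int)

lemma eval_mpoly_var [simp]: "eval_mpoly (var i) x = x $ i"
proof -
  have "(\<Prod>j\<in>UNIV. (x $ j) ^ Poly_Mapping.lookup (Poly_Mapping.single i (1::nat)) j)
      = (\<Prod>j\<in>UNIV. if j = i then x $ j else 1)"
    by (intro prod.cong refl) (simp add: lookup_single when_def)
  then show ?thesis by (simp add: var_def eval_mpoly_single)
qed

lemma var_power: "var i ^ n = Poly_Mapping.single (Poly_Mapping.single i n) 1"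
  by (induction n) (simp_all add: var_def mult_single flip: single_add)

lemma monomial_eq_prod_var:
  fixes m :: "'v::finite \<Rightarrow>\<^sub>0 nat"
  shows "Poly_Mapping.single m c = const_mpoly c * (\<Prod>i\<in>UNIV. var i ^ Poly_Mapping.lookup m i)"
proof -
  have prod: "(\<Prod>i\<in>A. var i ^ Poly_Mapping.lookup m i)
      = (Poly_Mapping.single (\<Sum>i\<in>A. Poly_Mapping.single i (Poly_Mapping.lookup m i)) 1 :: 'v mpoly)"
    if "finite A" for A
    using that by induction (simp_all add: var_power mult_single)
  have "(\<Sum>i\<in>UNIV. Poly_Mapping.single i (Poly_Mapping.lookup m i)) = m"
    by (rule poly_mapping_eqI) (simp add: lookup_sum lookup_single when_def)
  then show ?thesis by (simp add: prod mult_single)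
qed

text \<open>An ideal that contains all \<open>z\<^sub>i - x\<^sub>i\<close> identifies each polynomial with its value at \<open>x\<close>.\<close>

lemma congruent_to_value_modulo_point:
  fixes p :: "'v::finite mpoly"
  assumes point: "\<And>i. var i - const_mpoly (x $ i) \<in> ideal_gen G"
  shows "p - const_mpoly (eval_mpoly p x) \<in> ideal_gen G"
proof -
  define cong where "cong p \<longleftrightarrow> p - const_mpoly (eval_mpoly p x) \<in> ideal_gen G" for p
  have const: "cong (const_mpoly c)" for c
    by (simp add: cong_def ring_module.span_zero)
  have var: "cong (var i)" for i using point by (simp add: cong_def)
  have add: "cong (p + q)" if "cong p" "cong q" for p q
    using ring_module.span_add[OF that[unfolded cong_def]]
    by (simp add: cong_def single_add algebra_simps)
  have mult: "cong (p * q)" if "cong p" "cong q" for p q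
  proof -
    have "p * q - const_mpoly (eval_mpoly (p * q) x) = q * (p - const_mpoly (eval_mpoly p x))
        + const_mpoly (eval_mpoly p x) * (q - const_mpoly (eval_mpoly q x))"
      by (simp add: mult_single algebra_simps)
    then show ?thesis
      using that by (auto simp: cong_def intro!: ring_module.span_add ring_module.span_scale)
  qed
  have one: "cong 1" using const[of 1] by simp
  have power: "cong (p ^ n)" if "cong p" for p n
    by (induction n) (auto intro: one mult that)
  have "cong (\<Prod>i\<in>A. var i ^ Poly_Mapping.lookup m i)" if "finite A" for A and m :: "'v \<Rightarrow>\<^sub>0 nat"
    using that by induction (auto intro: one mult power var)
  then have monomial: "cong (Poly_Mapping.single m c)" for m c
    by (subst monomial_eq_prod_var) (auto intro: mult const)
  have "cong (\<Sum>m\<in>K. Poly_Mapping.single m (Poly_Mapping.lookup p m))" if "finite K" for K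
    using that const[of 0] by induction (auto intro: add monomial)
  then have "cong p"
    by (subst mpoly_eq_sum_monomials[of "Poly_Mapping.keys p"]) auto
  then show ?thesis by (simp add: cong_def)
qed

interpretation mpoly_vs: vector_space "\<lambda>c p. const_mpoly c * (p :: 'v mpoly)"
proof unfold_locales
  fix a b :: complex and p :: "'v mpoly"
  have "const_mpoly a * const_mpoly b = const_mpoly (a * b)" by (simp add: mult_single)
  then show "const_mpoly a * (const_mpoly b * p) = const_mpoly (a * b) * p" by (metis mult.assoc)
qed (simp_all add: algebra_simps single_add)

text \<open>The polynomials supported on \<open>K\<close> form a space of dimension at most \<open>card K\<close>. The dependence is indexed by
  \<open>A\<close> and not by the set of polynomials, so that repetitions in the family count as dependence.\<close>

lemma infinite_family_finite_support_dependent: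
  fixes h :: "complex \<Rightarrow> 'v mpoly"
  assumes "infinite A" "finite K" and keys: "\<And>c. c \<in> A \<Longrightarrow> Poly_Mapping.keys (h c) \<subseteq> K"
  obtains B l where "finite B" "B \<subseteq> A" "(\<Sum>c\<in>B. const_mpoly (l c) * h c) = 0" "\<exists>c\<in>B. l c \<noteq> 0"
proof (cases "inj_on h A")
  case False
  then obtain c d where "c \<in> A" "d \<in> A" "c \<noteq> d" "h c = h d" by (auto simp: inj_on_def)
  then show ?thesis
    by (intro that[of "{c, d}" "\<lambda>e. if e = c then 1 else -1"]) (auto simp: single_uminus)
next
  case True
  have "h ` A \<subseteq> mpoly_vs.span ((\<lambda>m. Poly_Mapping.single m 1) ` K)"
  proof clarify
    fix c assume "c \<in> A"
    then have "h c = (\<Sum>m\<in>K. const_mpoly (Poly_Mapping.lookup (h c) m) * Poly_Mapping.single m 1)"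
      using mpoly_eq_sum_monomials[OF \<open>finite K\<close> keys] by (simp add: mult_single)
    also have "\<dots> \<in> mpoly_vs.span ((\<lambda>m. Poly_Mapping.single m 1) ` K)"
      by (intro mpoly_vs.span_sum mpoly_vs.span_scale mpoly_vs.span_base) auto
    finally show "h c \<in> mpoly_vs.span ((\<lambda>m. Poly_Mapping.single m 1) ` K)" .
  qed
  moreover have "infinite (h ` A)" using assms(1) True by (simp add: finite_image_iff)
  ultimately have "mpoly_vs.dependent (h ` A)"
    using mpoly_vs.independent_span_bound[of "(\<lambda>m. Poly_Mapping.single m 1) ` K" "h ` A"] \<open>finite K\<close> by auto
  then obtain t l where t: "finite t" "t \<subseteq> h ` A" "(\<Sum>v\<in>t. const_mpoly (l v) * v) = 0" "\<exists>v\<in>t. l v \<noteq> 0"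
    by (auto simp: mpoly_vs.dependent_explicit)
  obtain B where B: "B \<subseteq> A" "t = h ` B" using t(2) by (auto simp: subset_image_iff)
  then have inj: "inj_on h B" using True by (auto intro: inj_on_subset)
  show ?thesis
  proof (rule that[of B "\<lambda>c. l (h c)"])
    show "finite B" using t(1) B inj by (simp add: finite_image_iff)
    show "(\<Sum>c\<in>B. const_mpoly (l (h c)) * h c) = 0"
      using t(3) B inj by (simp add: sum.reindex)
  qed (use B t in auto)
qed

section \<open>Hilbert's Nullstellensatz over the complex numbers\<close>

text \<open>Substitution of a polynomial \<open>y\<close> in several variables for the variable of \<open>q\<close>.\<close>

definition upoly_at :: "complex poly \<Rightarrow> 'v mpoly \<Rightarrow> 'v mpoly" where
  "upoly_at q y = poly (map_poly const_mpoly q) y"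

lemma upoly_at_0 [simp]: "upoly_at 0 y = 0"
  by (simp add: upoly_at_def)

lemma upoly_at_pCons [simp]: "upoly_at (pCons c q) y = const_mpoly c + y * upoly_at q y"
  by (cases "q = 0 \<and> c = 0") (auto simp: upoly_at_def map_poly_pCons)

lemma upoly_at_add [simp]: "upoly_at (p + q) y = upoly_at p y + upoly_at q y"
  by (induction p q rule: poly_induct2) (simp_all add: single_add algebra_simps)

lemma upoly_at_smult [simp]: "upoly_at (smult c q) y = const_mpoly c * upoly_at q y"
proof (induction q)
  case (pCons a q)
  have "const_mpoly (c * a) = (const_mpoly c * const_mpoly a :: 'a mpoly)"
    by (simp add: mult_single)
  then show ?case using pCons by (simp add: distrib_left mult.left_commute)
qed simp

lemma upoly_at_mult [simp]: "upoly_at (p * q) y = upoly_at p y * upoly_at q y"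
  by (induction p) (simp_all add: distrib_right mult.assoc)

lemma upoly_at_1 [simp]: "upoly_at 1 y = 1"
  by (simp add: one_pCons)

lemma upoly_at_sum [simp]: "upoly_at (\<Sum>a\<in>A. p a) y = (\<Sum>a\<in>A. upoly_at (p a) y)"
  by (induction A rule: infinite_finite_induct) simp_all

lemma upoly_at_prod [simp]: "upoly_at (\<Prod>a\<in>A. p a) y = (\<Prod>a\<in>A. upoly_at (p a) y)"
  by (induction A rule: infinite_finite_induct) simp_all

lemma upoly_at_linear [simp]: "upoly_at [:- c, 1:] y = y - const_mpoly c"
  by (simp add: single_uminus)

text \<open>Split off the linear factors of \<open>q\<close> one by one. If \<open>q = (T - c) q'\<close>, then modulo \<open>y - c\<close> a power of \<open>s\<close> lies in
  the ideal, so multiplying by this power allows the factor \<open>y - c\<close> of \<open>q(y)\<close> to be dropped.\<close>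

lemma power_in_ideal_if_in_all_fibres:
  fixes s y :: "'v mpoly"
  assumes fibre: "\<And>c. \<exists>N. s ^ N \<in> ideal_gen (insert (y - const_mpoly c) G)"
    and "q \<noteq> 0" "s ^ M * upoly_at q y \<in> ideal_gen G"
  shows "\<exists>N. s ^ N \<in> ideal_gen G"
  using assms(2,3)
proof (induction "degree q" arbitrary: q M)
  case 0
  then obtain c where c: "q = [:c:]" "c \<noteq> 0" by (auto elim: degree_eq_zeroE)
  then have "const_mpoly (inverse c) * (s ^ M * upoly_at q y) = s ^ M * (const_mpoly (inverse c) * const_mpoly c)"
    by (simp add: mult.left_commute)
  also have "\<dots> = s ^ M" using c by (simp add: mult_single)
  finally show ?case using ring_module.span_scale[OF 0(3)] by metis
next
  case (Suc n)
  obtain c where "poly q c = 0"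
    using Suc.hyps(2) alg_closed_imp_poly_has_root[of q] by auto
  then obtain q' where q': "q = [:- c, 1:] * q'" by (auto simp: poly_eq_0_iff_dvd elim: dvdE)
  with Suc.prems have "q' \<noteq> 0" by auto
  then have deg: "n = degree q'" using Suc.hyps(2) by (simp add: q' degree_mult_eq del: mult_pCons_left)
  obtain N h where h: "s ^ N - h * (y - const_mpoly c) \<in> ideal_gen G"
    using fibre[of c] by (auto simp: ring_module.span_breakdown_eq)
  have "s ^ (M + N) * upoly_at q' y
      = (s ^ M * upoly_at q' y) * (s ^ N - h * (y - const_mpoly c)) + h * (s ^ M * upoly_at q y)"
    unfolding q' upoly_at_mult upoly_at_linear by (simp add: algebra_simps power_add)
  also have "\<dots> \<in> ideal_gen G"
    by (rule ring_module.span_add[OF ring_module.span_scale[OF h] ring_module.span_scale[OF Suc.prems(2)]])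
  finally show ?case
    by (rule Suc.hyps(1)[OF deg \<open>q' \<noteq> 0\<close>])
qed

text \<open>The variable \<open>y\<close> can be specialised to a number without a power of \<open>s\<close> entering the ideal. Otherwise
  each complex \<open>c\<close> has an identity \<open>s\<^sup>N \<equiv> h (y - c)\<close> modulo the ideal. There are uncountably many \<open>c\<close>, but
  only countably many exponents \<open>N\<close> and supports of \<open>h\<close>; so infinitely many \<open>c\<close> share both, and their
  \<open>h\<close> are linearly dependent. Clearing denominators in the dependence of \<open>s\<^sup>N / (y - c)\<close> yields a
  nonzero polynomial \<open>q\<close> in one variable with \<open>s\<^sup>N q(y)\<close> in the ideal.\<close>

lemma ex_fibre_avoiding_powers:
  fixes s y :: "'v::finite mpoly"
  assumes avoid: "\<And>N. s ^ N \<notin> ideal_gen G"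
  shows "\<exists>c. \<forall>N. s ^ N \<notin> ideal_gen (insert (y - const_mpoly c) G)"
proof (rule ccontr)
  assume "\<not> ?thesis"
  then have fibre: "\<exists>N. s ^ N \<in> ideal_gen (insert (y - const_mpoly c) G)" for c by blast
  then have "\<exists>N h. s ^ N - h * (y - const_mpoly c) \<in> ideal_gen G" for c
    by (auto simp: ring_module.span_breakdown_eq)
  then obtain N h where h: "\<And>c. s ^ N c - h c * (y - const_mpoly c) \<in> ideal_gen G" by metis
  have inj: "inj (Poly_Mapping.lookup :: ('v \<Rightarrow>\<^sub>0 nat) \<Rightarrow> _)"
    by (intro injI poly_mapping_eqI) simp
  have "countable (UNIV :: ('v \<Rightarrow>\<^sub>0 nat) set)"
    by (rule countable_image_inj_on[OF _ inj]) (rule countableI_type)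
  then have "countable (UNIV \<times> {K :: ('v \<Rightarrow>\<^sub>0 nat) set. finite K} :: (nat \<times> _) set)"
    by (intro countable_SIGMA countableI_type) (use countable_Collect_finite_subset[of UNIV] in auto)
  then have "countable (range (\<lambda>c. (N c, Poly_Mapping.keys (h c))))"
    by (rule countable_subset[rotated]) auto
  moreover have "UNIV = (\<Union>t\<in>range (\<lambda>c. (N c, Poly_Mapping.keys (h c))). {c. (N c, Poly_Mapping.keys (h c)) = t})"
    by auto
  ultimately obtain t where "uncountable {c. (N c, Poly_Mapping.keys (h c)) = t}"
    using uncountable_UNIV_complex by (metis (no_types, lifting) countable_UN)
  then have inf: "infinite {c. (N c, Poly_Mapping.keys (h c)) = t}" by (metis countable_finite)
  then obtain d where "(N d, Poly_Mapping.keys (h d)) = t" by (metis (mono_tags) Collect_empty_eq finite.emptyI)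
  then have "finite (snd t)" by auto
  from inf this obtain B l where B: "finite B" "B \<subseteq> {c. (N c, Poly_Mapping.keys (h c)) = t}"
    and dep: "(\<Sum>c\<in>B. const_mpoly (l c) * h c) = 0" and nontriv: "\<exists>c\<in>B. l c \<noteq> 0"
    by (rule infinite_family_finite_support_dependent) auto
  have N: "N c = fst t" if "c \<in> B" for c using B(2) that by auto
  define q where "q = (\<Sum>c\<in>B. smult (l c) (\<Prod>e\<in>B-{c}. [:- e, 1:]))"
  \<comment> \<open>At a point \<open>c\<close> with \<open>l c \<noteq> 0\<close> only the summand of \<open>c\<close> survives.\<close>
  have "q \<noteq> 0"
  proof -
    obtain c where c: "c \<in> B" "l c \<noteq> 0" using nontriv by blast
    have "poly q c = (\<Sum>d\<in>B. l d * (\<Prod>e\<in>B-{d}. c - e))"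
      by (simp add: q_def poly_sum poly_prod)
    also have "\<dots> = (\<Sum>d\<in>B. if d = c then l c * (\<Prod>e\<in>B-{c}. c - e) else 0)"
      by (intro sum.cong refl) (use c B(1) in auto)
    also have "\<dots> = l c * (\<Prod>e\<in>B-{c}. c - e)" using c B(1) by simp
    also have "\<dots> \<noteq> 0" using c B(1) by auto
    finally show ?thesis by auto
  qed
  have expand: "(a * L) * (S - h * z) = S * (a * L) - (z * L) * (a * h)" for a L S h z :: "'v mpoly"
    by (simp add: algebra_simps)
  let ?L = "\<lambda>c. \<Prod>e\<in>B-{c}. y - const_mpoly e"
  have "(\<Sum>c\<in>B. (const_mpoly (l c) * ?L c) * (s ^ N c - h c * (y - const_mpoly c)))
      = (\<Sum>c\<in>B. s ^ fst t * (const_mpoly (l c) * ?L c) - (\<Prod>e\<in>B. y - const_mpoly e) * (const_mpoly (l c) * h c))"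
  proof (intro sum.cong refl)
    fix c assume c: "c \<in> B"
    have "(\<Prod>e\<in>B. y - const_mpoly e) = (y - const_mpoly c) * ?L c"
      by (rule prod.remove[OF B(1) c])
    then show "(const_mpoly (l c) * ?L c) * (s ^ N c - h c * (y - const_mpoly c))
        = s ^ fst t * (const_mpoly (l c) * ?L c) - (\<Prod>e\<in>B. y - const_mpoly e) * (const_mpoly (l c) * h c)"
      using N[OF c] by (simp only: expand)
  qed
  also have "\<dots> = s ^ fst t * upoly_at q y"
    unfolding q_def upoly_at_sum upoly_at_smult upoly_at_prod upoly_at_linear
    using dep by (simp add: sum_subtractf flip: sum_distrib_left)
  finally have "s ^ fst t * upoly_at q y \<in> ideal_gen G"
    using h by (metis (no_types, lifting) ring_module.span_scale ring_module.span_sum)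
  then show False
    using power_in_ideal_if_in_all_fibres[OF fibre \<open>q \<noteq> 0\<close>] avoid by blast
qed

text \<open>If no power of \<open>s\<close> lies in the ideal, specialising the variables one after the other gives a point at
  which all of \<open>G\<close> vanishes and \<open>s\<close> does not.\<close>

theorem hilbert_nullstellensatz:
  fixes s :: "'v::finite mpoly"
  assumes vanish: "\<And>x. (\<And>p. p \<in> G \<Longrightarrow> eval_mpoly p x = 0) \<Longrightarrow> eval_mpoly s x = 0"
  shows "\<exists>N. s ^ N \<in> ideal_gen G"
proof (rule ccontr)
  assume avoid: "\<not> ?thesis"
  have "\<exists>H c. G \<subseteq> H \<and> (\<forall>N. s ^ N \<notin> ideal_gen H) \<and> (\<forall>i\<in>A. var i - const_mpoly (c i) \<in> ideal_gen H)"
    if "finite A" for A :: "'v set"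
    using that
  proof induction
    case empty
    then show ?case using avoid by auto
  next
    case (insert j A)
    then obtain H c where H: "G \<subseteq> H" "\<And>N. s ^ N \<notin> ideal_gen H"
      "\<And>i. i \<in> A \<Longrightarrow> var i - const_mpoly (c i) \<in> ideal_gen H" by blast
    obtain d where d: "\<And>N. s ^ N \<notin> ideal_gen (insert (var j - const_mpoly d) H)"
      using ex_fibre_avoiding_powers[OF H(2)] by blast
    let ?H = "insert (var j - const_mpoly d) H"
    have "ideal_gen H \<subseteq> ideal_gen ?H" by (intro ring_module.span_mono) auto
    then have "\<forall>i\<in>insert j A. var i - const_mpoly ((c(j := d)) i) \<in> ideal_gen ?H"
      using H(3) by (auto intro: ring_module.span_base)
    then show ?case using H(1) d by (intro exI[of _ ?H] exI[of _ "c(j := d)"]) auto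
  qed
  then obtain H c where H: "G \<subseteq> H" "\<And>N. s ^ N \<notin> ideal_gen H"
      "\<And>i. var i - const_mpoly (c i) \<in> ideal_gen H" by (metis UNIV_I finite_code)
  define x where "x = (\<chi> i. c i)"
  have at_x: "p - const_mpoly (eval_mpoly p x) \<in> ideal_gen H" for p
    by (rule congruent_to_value_modulo_point) (simp add: x_def H(3))
  have "eval_mpoly p x = 0" if "p \<in> G" for p
  proof (rule ccontr)
    let ?a = "eval_mpoly p x"
    assume a: "?a \<noteq> 0"
    have "p \<in> ideal_gen H" using that H(1) by (auto intro: ring_module.span_base)
    from ring_module.span_diff[OF this at_x[of p]] have "const_mpoly ?a \<in> ideal_gen H" by simp
    then have "const_mpoly (inverse ?a) * const_mpoly ?a \<in> ideal_gen H" by (rule ring_module.span_scale)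
    then have "s ^ 0 \<in> ideal_gen H" using a by (simp add: mult_single)
    then show False using H(2) by blast
  qed
  then have "eval_mpoly s x = 0" by (rule vanish)
  then have "s ^ 1 \<in> ideal_gen H" using at_x[of s] by simp
  then show False using H(2) by blast
qed

section \<open>Powers of the variables form a regular sequence\<close>

lemma lookup_monomial_mult:
  fixes p :: "'v mpoly"
  shows "Poly_Mapping.lookup (Poly_Mapping.single e c * p) (e + m) = c * Poly_Mapping.lookup p m"
proof -
  have "Poly_Mapping.single e c * p = Poly_Mapping.single e c *
      (\<Sum>n\<in>Poly_Mapping.keys p. Poly_Mapping.single n (Poly_Mapping.lookup p n))"
    by (simp flip: mpoly_eq_sum_monomials)
  also have "\<dots> = (\<Sum>n\<in>Poly_Mapping.keys p. Poly_Mapping.single (e + n) (c * Poly_Mapping.lookup p n))"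
    by (simp add: sum_distrib_left mult_single)
  finally have "Poly_Mapping.lookup (Poly_Mapping.single e c * p) (e + m)
      = (\<Sum>n\<in>Poly_Mapping.keys p. if n = m then c * Poly_Mapping.lookup p n else 0)"
    by (simp add: lookup_sum lookup_single when_def)
  then show ?thesis by (auto simp: in_keys_iff)
qed

lemma minus_single_plus_single:
  assumes "n \<le> Poly_Mapping.lookup m i"
  shows "m - Poly_Mapping.single i n + Poly_Mapping.single i n = (m :: 'v \<Rightarrow>\<^sub>0 nat)"
  using assms by (intro poly_mapping_eqI) (auto simp: lookup_add lookup_minus lookup_single when_def)

text \<open>Membership in a monomial ideal can be tested on single monomials, which makes regularity of powers of the variables
  a statement about exponents.\<close>

lemma in_ideal_gen_var_powers_iff:
  fixes p :: "'v mpoly"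
  shows "p \<in> ideal_gen ((\<lambda>i. var i ^ N i) ` A) \<longleftrightarrow>
    (\<forall>m\<in>Poly_Mapping.keys p. \<exists>i\<in>A. N i \<le> Poly_Mapping.lookup m i)"
proof
  assume "p \<in> ideal_gen ((\<lambda>i. var i ^ N i) ` A)"
  then show "\<forall>m\<in>Poly_Mapping.keys p. \<exists>i\<in>A. N i \<le> Poly_Mapping.lookup m i"
  proof (induction rule: ring_module.span_induct_alt)
    case base
    then show ?case by simp
  next
    case (step c x y)
    then obtain i where i: "i \<in> A" "x = Poly_Mapping.single (Poly_Mapping.single i (N i)) 1"
      by (auto simp: var_power)
    have "\<exists>i\<in>A. N i \<le> Poly_Mapping.lookup m i" if m: "m \<in> Poly_Mapping.keys (c * x)" for m
    proof -
      obtain a where "m = a + Poly_Mapping.single i (N i)"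
        using subsetD[OF keys_mult m] i by auto
      then show ?thesis using i(1) by (intro bexI[of _ i]) (simp_all add: lookup_add)
    qed
    then show ?case
      using step.IH keys_add[of "c * x" y] by blast
  qed
next
  assume R: "\<forall>m\<in>Poly_Mapping.keys p. \<exists>i\<in>A. N i \<le> Poly_Mapping.lookup m i"
  have "Poly_Mapping.single m (Poly_Mapping.lookup p m) \<in> ideal_gen ((\<lambda>i. var i ^ N i) ` A)"
    if m: "m \<in> Poly_Mapping.keys p" for m
  proof -
    obtain i where i: "i \<in> A" "N i \<le> Poly_Mapping.lookup m i" using R m by blast
    have "m - Poly_Mapping.single i (N i) + Poly_Mapping.single i (N i) = m"
      by (rule minus_single_plus_single[OF i(2)])
    then have "Poly_Mapping.single m (Poly_Mapping.lookup p m)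
        = Poly_Mapping.single (m - Poly_Mapping.single i (N i)) (Poly_Mapping.lookup p m) * var i ^ N i"
      by (simp add: var_power mult_single)
    then show ?thesis using i(1) by (auto intro: ring_module.span_scale ring_module.span_base)
  qed
  then have "(\<Sum>m\<in>Poly_Mapping.keys p. Poly_Mapping.single m (Poly_Mapping.lookup p m))
      \<in> ideal_gen ((\<lambda>i. var i ^ N i) ` A)"
    by (rule ring_module.span_sum)
  then show "p \<in> ideal_gen ((\<lambda>i. var i ^ N i) ` A)"
    by (simp flip: mpoly_eq_sum_monomials)
qed

lemma var_powers_regular:
  fixes y :: "'v mpoly"
  assumes "i \<notin> A" and mem: "var i ^ N i * y \<in> ideal_gen ((\<lambda>i. var i ^ N i) ` A)"
  shows "y \<in> ideal_gen ((\<lambda>i. var i ^ N i) ` A)"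
  unfolding in_ideal_gen_var_powers_iff
proof
  fix m assume "m \<in> Poly_Mapping.keys y"
  then have "Poly_Mapping.single i (N i) + m \<in> Poly_Mapping.keys (var i ^ N i * y)"
    by (simp add: var_power in_keys_iff lookup_monomial_mult)
  then obtain j where "j \<in> A" "N j \<le> Poly_Mapping.lookup (Poly_Mapping.single i (N i) + m) j"
    using mem unfolding in_ideal_gen_var_powers_iff by blast
  then show "\<exists>j\<in>A. N j \<le> Poly_Mapping.lookup m j"
    using \<open>i \<notin> A\<close> by (auto simp: lookup_add lookup_single when_def split: if_splits)
qed


section \<open>Integer weights and the Euler identity\<close>

definition weight :: "('v::finite \<Rightarrow> int) \<Rightarrow> ('v \<Rightarrow>\<^sub>0 nat) \<Rightarrow> int" where
  "weight w m = (\<Sum>i\<in>UNIV. w i * int (Poly_Mapping.lookup m i))"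

text \<open>For a singleton \<open>S\<close> this is weighted homogeneity. General \<open>S\<close> also expresses that a polynomial has no part of
  a given weight, or only parts of large weight.\<close>

definition weights_in :: "('v::finite \<Rightarrow> int) \<Rightarrow> int set \<Rightarrow> 'v mpoly \<Rightarrow> bool" where
  "weights_in w S p \<longleftrightarrow> (\<forall>m\<in>Poly_Mapping.keys p. weight w m \<in> S)"

lemma weight_add: "weight w (m + n) = weight w m + weight w n"
  by (simp add: weight_def lookup_add distrib_left sum.distrib)

lemma weight_single [simp]: "weight w (Poly_Mapping.single i n) = w i * int n"
proof -
  have "weight w (Poly_Mapping.single i n) = (\<Sum>j\<in>UNIV. if j = i then w i * int n else 0)"
    unfolding weight_def by (intro sum.cong refl) (simp add: lookup_single when_def)
  then show ?thesis by simp
qed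

lemma weights_in_zero [simp]: "weights_in w S 0"
  by (simp add: weights_in_def)

lemma weights_in_add: "weights_in w S p \<Longrightarrow> weights_in w S q \<Longrightarrow> weights_in w S (p + q)"
  using keys_add[of p q] by (auto simp: weights_in_def)

lemma weights_in_diff:
  fixes p q :: "'v::finite mpoly"
  shows "weights_in w S p \<Longrightarrow> weights_in w S q \<Longrightarrow> weights_in w S (p - q)"
  by (auto simp: weights_in_def in_keys_iff lookup_minus)

lemma weights_in_sum: "(\<And>a. a \<in> A \<Longrightarrow> weights_in w S (p a)) \<Longrightarrow> weights_in w S (\<Sum>a\<in>A. p a)"
  by (induction A rule: infinite_finite_induct) (auto intro: weights_in_add)

lemma weights_in_mult:
  assumes "weights_in w S p" "weights_in w R q" "\<And>s r. s \<in> S \<Longrightarrow> r \<in> R \<Longrightarrow> s + r \<in> U"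
  shows "weights_in w U (p * q)"
  unfolding weights_in_def
proof
  fix m assume "m \<in> Poly_Mapping.keys (p * q)"
  then obtain k l where "m = k + l" "k \<in> Poly_Mapping.keys p" "l \<in> Poly_Mapping.keys q"
    using keys_mult by blast
  then show "weight w m \<in> U" using assms by (simp add: weights_in_def weight_add)
qed

lemma weights_in_var [simp]: "weights_in w {w i} (var i)"
  by (simp add: weights_in_def var_def)

lemma weights_in_of_int_mult: "weights_in w S p \<Longrightarrow> weights_in w S (of_int n * p)"
  by (rule weights_in_mult[of w "{0}"]) (auto simp: weights_in_def weight_def simp flip: single_of_int)

lemma weights_in_nonneg: "(\<And>i. w i \<ge> 0) \<Longrightarrow> weights_in w {0..} p"
  by (simp add: weights_in_def weight_def sum_nonneg)

lemma weights_in_disjoint_eq_zero: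
  assumes "weights_in w S p" "weights_in w (- S) p"
  shows "p = 0"
  using assms by (auto simp: weights_in_def simp flip: keys_eq_empty)

lemma weight_part_exists:
  fixes g :: "'v::finite mpoly"
  obtains h where "weights_in w {a} h" "weights_in w (- {a}) (g - h)"
proof -
  define h where "h = (\<Sum>m\<in>{m\<in>Poly_Mapping.keys g. weight w m = a}. Poly_Mapping.single m (Poly_Mapping.lookup g m))"
  have lookup: "Poly_Mapping.lookup h n = (if weight w n = a then Poly_Mapping.lookup g n else 0)" for n
    by (auto simp: h_def lookup_sum lookup_single when_def in_keys_iff)
  show ?thesis
    by (rule that[of h]) (auto simp: weights_in_def in_keys_iff lookup lookup_minus split: if_splits)
qed

text \<open>A monomial without \<open>z\<^sub>i\<close> is harmless: the truncated difference of exponents is then meaningless, but its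
  coefficient is zero.\<close>

lemma weights_in_pdiff:
  fixes f :: "'v::finite mpoly"
  assumes "weights_in w {d} f"
  shows "weights_in w {d - w i} (pdiff i f)"
  unfolding pdiff_def
proof (rule weights_in_sum)
  fix m assume m: "m \<in> Poly_Mapping.keys f"
  show "weights_in w {d - w i} (Poly_Mapping.single (m - Poly_Mapping.single i 1)
      (of_nat (Poly_Mapping.lookup m i) * Poly_Mapping.lookup f m))"
  proof (cases "Poly_Mapping.lookup m i = 0")
    case False
    then have "m - Poly_Mapping.single i 1 + Poly_Mapping.single i 1 = m"
      by (intro minus_single_plus_single) simp
    then have "weight w (m - Poly_Mapping.single i 1) + w i = weight w m"
      by (metis weight_add weight_single mult.right_neutral of_nat_1)
    then show ?thesis using assms m by (auto simp: weights_in_def)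
  qed simp
qed

lemma euler_identity:
  fixes f :: "'v::finite mpoly"
  assumes "weights_in w {d} f"
  shows "(\<Sum>i\<in>UNIV. of_int (w i) * var i * pdiff i f) = of_int d * f"
proof -
  have monomial: "of_int (w i) * var i * Poly_Mapping.single (m - Poly_Mapping.single i 1)
        (of_nat (Poly_Mapping.lookup m i) * c)
      = Poly_Mapping.single m (of_int (w i * int (Poly_Mapping.lookup m i)) * c)"
    for i c and m :: "'v \<Rightarrow>\<^sub>0 nat"
  proof (cases "Poly_Mapping.lookup m i = 0")
    case False
    then have "Poly_Mapping.single i 1 + (m - Poly_Mapping.single i 1) = m"
      by (subst add.commute, intro minus_single_plus_single) simp
    then show ?thesis
      by (simp add: var_def mult_single mult.assoc flip: single_of_int)
  qed simp
  have "(\<Sum>i\<in>UNIV. of_int (w i) * var i * pdiff i f)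
      = (\<Sum>i\<in>UNIV. \<Sum>m\<in>Poly_Mapping.keys f.
          Poly_Mapping.single m (of_int (w i * int (Poly_Mapping.lookup m i)) * Poly_Mapping.lookup f m))"
    by (simp only: pdiff_def sum_distrib_left monomial)
  also have "\<dots> = (\<Sum>m\<in>Poly_Mapping.keys f. \<Sum>i\<in>UNIV.
          Poly_Mapping.single m (of_int (w i * int (Poly_Mapping.lookup m i)) * Poly_Mapping.lookup f m))"
    by (rule sum.swap)
  also have "\<dots> = (\<Sum>m\<in>Poly_Mapping.keys f. Poly_Mapping.single m (of_int d * Poly_Mapping.lookup f m))"
  proof (intro sum.cong refl)
    fix m assume "m \<in> Poly_Mapping.keys f"
    then have "d = weight w m" using assms by (simp add: weights_in_def)
    then have "of_int d = (\<Sum>i\<in>UNIV. of_int (w i * int (Poly_Mapping.lookup m i)) :: complex)"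
      by (simp only: weight_def of_int_sum)
    moreover have "(\<Sum>i\<in>UNIV. Poly_Mapping.single m (c i)) = Poly_Mapping.single m (\<Sum>i\<in>UNIV. c i)"
      for c :: "'v \<Rightarrow> complex"
      by (rule poly_mapping_eqI) (simp add: lookup_sum lookup_single when_def)
    ultimately show "(\<Sum>i\<in>UNIV. Poly_Mapping.single m (of_int (w i * int (Poly_Mapping.lookup m i)) * Poly_Mapping.lookup f m))
        = Poly_Mapping.single m (of_int d * Poly_Mapping.lookup f m)"
      by (simp add: sum_distrib_right)
  qed
  also have "\<dots> = of_int d * (\<Sum>m\<in>Poly_Mapping.keys f. Poly_Mapping.single m (Poly_Mapping.lookup f m))"
    by (simp add: sum_distrib_left mult_single flip: single_of_int)
  finally show ?thesis by (simp flip: mpoly_eq_sum_monomials)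
qed

section \<open>Fields tangent to a smooth hypersurface\<close>

text \<open>The coefficients of \<open>d P - g R\<close>, where \<open>R = \<Sum> w\<^sub>i z\<^sub>i \<partial>/\<partial>z\<^sub>i\<close>, form a syzygy of the partial derivatives of
  \<open>f\<close>, and \<open>large\<close> says that the other partial derivatives are too heavy to contribute to the weight
  \<open>a + w\<^sub>i\<close> of \<open>P\<^sub>i\<close>. Replacing \<open>g\<close> by its part of weight \<open>a\<close> removes the other weights from the
  \<open>i\<close>-th coefficient.\<close>

lemma invariant_field_proportional_to_radial:
  fixes f g :: "'v::{finite,linorder} mpoly" and P :: "'v vfield"
  assumes w: "\<And>i. w i \<ge> 0"
    and f: "weights_in w {d} f" and P: "\<And>i. weights_in w {a + w i} (P $ i)"
    and d: "d \<noteq> 0" and large: "\<And>i j. i \<noteq> j \<Longrightarrow> a + w i + w j < d"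
    and smooth: "strongly_quasi_smooth f"
    and invariant: "apply_vfield P f = g * f"
  obtains h where "\<And>i. of_int d * P $ i = of_int (w i) * var i * h"
proof -
  define p where "p i = pdiff i f" for i
  define Q where "Q i = of_int d * P $ i - of_int (w i) * var i * g" for i
  have euler: "(\<Sum>i\<in>UNIV. of_int (w i) * var i * p i) = of_int d * f"
    unfolding p_def by (rule euler_identity[OF f])
  have "\<exists>N. var i ^ N \<in> ideal_gen (range p)" for i
  proof (rule hilbert_nullstellensatz)
    fix x assume "\<And>q. q \<in> range p \<Longrightarrow> eval_mpoly q x = 0"
    then have crit: "eval_mpoly (p i) x = 0" for i by blast
    then have "eval_mpoly (of_int d * f) x = 0" by (simp flip: euler)
    then have "eval_mpoly f x = 0" using d by simp
    then have "x = 0" using smooth crit unfolding strongly_quasi_smooth_def p_def by blast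
    then show "eval_mpoly (var i) x = 0" by simp
  qed
  then obtain N where N: "\<And>i. var i ^ N i \<in> ideal_gen (range p)" by metis
  have "(\<Sum>i\<in>UNIV. Q i * p i) = of_int d * apply_vfield P f - g * (of_int d * f)"
    unfolding euler[symmetric] apply_vfield_def sum_distrib_left sum_subtractf[symmetric]
    by (intro sum.cong refl) (simp add: Q_def p_def algebra_simps)
  also have "\<dots> = 0" by (simp add: invariant mult_ac)
  finally have syzygy: "(\<Sum>i\<in>UNIV. Q i * p i) = 0" .
  have "\<exists>b. \<forall>i. Q i = (\<Sum>j\<in>-{i}. b i j * p j)"
  proof (rule syzygy_coefficient_in_other_ideal[of "\<lambda>i. var i ^ N i" p Q])
    fix A i y assume "i \<notin> A" "var i ^ N i * y \<in> ideal_gen ((\<lambda>i. var i ^ N i) ` A)"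
    then show "y \<in> ideal_gen ((\<lambda>i. var i ^ N i) ` A)" by (rule var_powers_regular)
  qed (use N syzygy in blast)+
  then obtain b where b: "\<And>i. Q i = (\<Sum>j\<in>-{i}. b i j * p j)" by blast
  obtain h where h: "weights_in w {a} h" and rest: "weights_in w (- {a}) (g - h)"
    by (rule weight_part_exists)
  \<comment> \<open>The difference has only weight \<open>a + w\<^sub>i\<close> by construction, and no part of this weight by the syzygy.\<close>
  have "of_int d * P $ i - of_int (w i) * var i * h = 0" (is "?E = 0") for i
  proof (rule weights_in_disjoint_eq_zero)
    have "weights_in w {a + w i} (of_int (w i) * (var i * h))"
      by (intro weights_in_of_int_mult weights_in_mult[OF weights_in_var h]) auto
    then show "weights_in w {a + w i} ?E"
      by (auto intro!: weights_in_diff weights_in_of_int_mult P simp: mult.assoc)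
    have "weights_in w (- {a + w i}) (\<Sum>j\<in>-{i}. b i j * p j)"
    proof (rule weights_in_sum)
      fix j assume "j \<in> - {i}"
      then have "a + w i + w j < d" by (intro large) auto
      then show "weights_in w (- {a + w i}) (b i j * p j)"
        unfolding p_def by (intro weights_in_mult[OF weights_in_nonneg[OF w] weights_in_pdiff[OF f]]) auto
    qed
    moreover have "weights_in w (- {a + w i}) (of_int (w i) * (var i * (g - h)))"
      by (intro weights_in_of_int_mult weights_in_mult[OF weights_in_var rest]) auto
    ultimately have "weights_in w (- {a + w i}) (Q i + of_int (w i) * (var i * (g - h)))"
      unfolding b by (rule weights_in_add)
    then show "weights_in w (- {a + w i}) ?E"
      by (simp add: Q_def algebra_simps)
  qed
  then show ?thesis by (intro that[of h]) simp
qed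

section \<open>Irreducibility of the toric variety\<close>

lemma zariski_open_locally_basic:
  fixes U :: "(complex ^ 'v::finite) set"
  assumes "openin zariski_topology U" "x \<in> U"
  obtains p where "eval_mpoly p x \<noteq> 0" "{y. eval_mpoly p y \<noteq> 0} \<subseteq> U"
proof -
  have "generate_topology_on {{x. eval_mpoly p x \<noteq> 0} | p. True} U"
    using assms(1) by (simp add: zariski_topology_def openin_topology_generated_by_iff)
  then have "\<forall>x\<in>U. \<exists>p. eval_mpoly p x \<noteq> 0 \<and> {y. eval_mpoly p y \<noteq> 0} \<subseteq> U"
  proof induction
    case (Int A B)
    show ?case
    proof
      fix x assume "x \<in> A \<inter> B"
      then obtain p q where "eval_mpoly p x \<noteq> 0" "{y. eval_mpoly p y \<noteq> 0} \<subseteq> A"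
          "eval_mpoly q x \<noteq> 0" "{y. eval_mpoly q y \<noteq> 0} \<subseteq> B"
        using Int.IH by (meson IntD1 IntD2)
      then show "\<exists>p. eval_mpoly p x \<noteq> 0 \<and> {y. eval_mpoly p y \<noteq> 0} \<subseteq> A \<inter> B"
        by (intro exI[of _ "p * q"]) auto
    qed
  next
    case (UN K)
    then show ?case by (meson Union_iff Union_upper subset_trans)
  qed auto
  then show ?thesis using assms(2) that by blast
qed

text \<open>Restriction to the line through two points reduces questions on nonvanishing to polynomials in one
  variable.\<close>

lemma eval_mpoly_on_line:
  fixes p :: "'v::finite mpoly"
  obtains P where "\<And>t. poly P t = eval_mpoly p (\<chi> i. x $ i + t * (y $ i - x $ i))"
proof (rule that)
  fix t
  show "poly (\<Sum>m\<in>Poly_Mapping.keys p. smult (Poly_Mapping.lookup p m)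
        (\<Prod>i\<in>UNIV. [:x $ i, y $ i - x $ i:] ^ Poly_Mapping.lookup m i)) t = eval_mpoly p (\<chi> i. x $ i + t * (y $ i - x $ i))"
    by (simp add: poly_sum poly_prod eval_mpoly_def)
qed

lemma zariski_basic_opens_meet:
  fixes p q :: "'v::finite mpoly"
  assumes "eval_mpoly p x \<noteq> 0" "eval_mpoly q y \<noteq> 0"
  obtains z where "eval_mpoly p z \<noteq> 0" "eval_mpoly q z \<noteq> 0"
proof -
  obtain P where P: "\<And>t. poly P t = eval_mpoly p (\<chi> i. x $ i + t * (y $ i - x $ i))" by (rule eval_mpoly_on_line) blast
  obtain Q where Q: "\<And>t. poly Q t = eval_mpoly q (\<chi> i. x $ i + t * (y $ i - x $ i))" by (rule eval_mpoly_on_line) blast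
  have "poly P 0 \<noteq> 0" "poly Q 1 \<noteq> 0" using assms by (simp_all add: P Q)
  then have "P * Q \<noteq> 0" by auto
  then obtain t where "poly (P * Q) t \<noteq> 0" using poly_all_0_iff_0 by blast
  then show ?thesis by (intro that[of "\<chi> i. x $ i + t * (y $ i - x $ i)"]) (simp_all flip: P Q)
qed

lemma exceptional_set_imp_coordinate_zero:
  assumes "\<Delta> \<noteq> {}" "x \<in> exceptional_set \<Delta> u"
  obtains i where "x $ i = 0"
  using assms by (auto simp: exceptional_set_def)

lemma topspace_zariski_topology: "topspace zariski_topology = UNIV"
proof -
  have "x \<in> {x. eval_mpoly (const_mpoly 1) x \<noteq> 0}" for x :: "complex ^ 'v::finite"
    using eval_mpoly_const[of 1 x] by simp
  then show ?thesis
    unfolding zariski_topology_def topology_generated_by_topspace by blast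
qed

lemma topspace_toric_topology:
  fixes u :: "'v::finite \<Rightarrow> int ^ 'n"
  shows "topspace (toric_topology \<Delta> u) = toric_variety \<Delta> u"
proof -
  have "{x. x \<notin> exceptional_set \<Delta> u \<and> torus_orbit u x \<in> toric_variety \<Delta> u} = - exceptional_set \<Delta> u"
    by (auto simp: toric_variety_def)
  moreover have "openin (subtopology zariski_topology (- exceptional_set \<Delta> u)) (- exceptional_set \<Delta> u)"
    by (metis openin_topspace topspace_subtopology topspace_zariski_topology Int_UNIV_left)
  ultimately show ?thesis
    unfolding toric_topology_def topology_generated_by_topspace by auto
qed

lemma torus_orbit_continuous:
  fixes u :: "'v::finite \<Rightarrow> int ^ 'n"
  shows "continuous_map (subtopology zariski_topology (- exceptional_set \<Delta> u)) (toric_topology \<Delta> u) (torus_orbit u)"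
  unfolding toric_topology_def
proof (rule continuous_on_generated_topo)
  fix U assume "U \<in> {U. U \<subseteq> toric_variety \<Delta> u \<and>
         openin (subtopology zariski_topology (- exceptional_set \<Delta> u))
           {x. x \<notin> exceptional_set \<Delta> u \<and> torus_orbit u x \<in> U}}"
  moreover have "torus_orbit u -` U \<inter> - exceptional_set \<Delta> u = {x. x \<notin> exceptional_set \<Delta> u \<and> torus_orbit u x \<in> U}"
    by blast
  ultimately show "openin (subtopology zariski_topology (- exceptional_set \<Delta> u))
      (torus_orbit u -` U \<inter> topspace (subtopology zariski_topology (- exceptional_set \<Delta> u)))"
    by (simp add: topspace_zariski_topology)
next
  show "torus_orbit u ` topspace (subtopology zariski_topology (- exceptional_set \<Delta> u)) \<subseteq> \<Union> {U. U \<subseteq> toric_variety \<Delta> u \<and>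
         openin (subtopology zariski_topology (- exceptional_set \<Delta> u))
           {x. x \<notin> exceptional_set \<Delta> u \<and> torus_orbit u x \<in> U}}"
    using topspace_toric_topology[of \<Delta> u]
    unfolding toric_topology_def topology_generated_by_topspace
    by (simp add: topspace_zariski_topology toric_variety_def)
qed

text \<open>Nonempty open sets of the toric variety contain the orbits of a nonempty set \<open>{p \<noteq> 0}\<close>, up to the
  exceptional set; this carries irreducibility over from affine space.\<close>

lemma toric_open_preimage_basic:
  fixes u :: "'v::finite \<Rightarrow> int ^ 'n"
  assumes "openin (toric_topology \<Delta> u) U" "x \<notin> exceptional_set \<Delta> u" "torus_orbit u x \<in> U"
  obtains p where "eval_mpoly p x \<noteq> 0"
    "\<And>y. y \<notin> exceptional_set \<Delta> u \<Longrightarrow> eval_mpoly p y \<noteq> 0 \<Longrightarrow> torus_orbit u y \<in> U"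
proof -
  have "openin (subtopology zariski_topology (- exceptional_set \<Delta> u))
      {y \<in> - exceptional_set \<Delta> u. torus_orbit u y \<in> U}"
    using openin_continuous_map_preimage[OF torus_orbit_continuous assms(1)]
    by (simp add: topspace_zariski_topology)
  then obtain V where V: "openin zariski_topology V"
    "{y \<in> - exceptional_set \<Delta> u. torus_orbit u y \<in> U} = V \<inter> - exceptional_set \<Delta> u"
    unfolding openin_subtopology by blast
  then have "x \<in> V" using assms by blast
  with V(1) obtain p where "eval_mpoly p x \<noteq> 0" "{y. eval_mpoly p y \<noteq> 0} \<subseteq> V"
    by (rule zariski_open_locally_basic)
  then show ?thesis using V(2) by (intro that[of p]) blast+
qed

lemma toric_variety_irreducible:
  fixes u :: "'v::finite \<Rightarrow> int ^ 'n"
  assumes "\<Delta> \<noteq> {}"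
  shows "irreducible_closed (toric_topology \<Delta> u) (toric_variety \<Delta> u)"
proof -
  let ?T = "toric_topology \<Delta> u" and ?Z = "exceptional_set \<Delta> u"
  \<comment> \<open>The exceptional set lies in the coordinate hyperplanes, so the product of the variables avoids it.\<close>
  have off_Z: "x \<notin> ?Z" if "eval_mpoly (\<Prod>i\<in>UNIV. var i) x \<noteq> 0" for x
  proof
    assume "x \<in> ?Z"
    then obtain i where "x $ i = 0" using exceptional_set_imp_coordinate_zero[OF assms] by blast
    then have "eval_mpoly (var i * (\<Prod>i\<in>UNIV-{i}. var i)) x = 0" by simp
    then show False using that by (simp flip: prod.remove)
  qed
  have prod_eval: "eval_mpoly (\<Prod>i\<in>A. var i) x = (\<Prod>i\<in>A. x $ i)" if "finite A" for A and x :: "complex ^ 'v"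
    using that eval_mpoly_const[of 1 x] by induction simp_all
  have one: "eval_mpoly (\<Prod>i\<in>UNIV. var i) ((\<chi> i. 1) :: complex ^ 'v) \<noteq> 0"
    by (simp add: prod_eval)
  have "toric_variety \<Delta> u \<subseteq> A \<or> toric_variety \<Delta> u \<subseteq> B"
    if AB: "closedin ?T A" "closedin ?T B" "toric_variety \<Delta> u \<subseteq> A \<union> B" for A B
  proof (rule ccontr)
    assume "\<not> ?thesis"
    then obtain x y where x: "x \<notin> ?Z" "torus_orbit u x \<notin> A" and y: "y \<notin> ?Z" "torus_orbit u y \<notin> B"
      by (auto simp: toric_variety_def)
    have orbit: "torus_orbit u z \<in> toric_variety \<Delta> u" if "z \<notin> ?Z" for z
      using that by (auto simp: toric_variety_def)
    have op: "openin ?T (toric_variety \<Delta> u - A)" "openin ?T (toric_variety \<Delta> u - B)"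
      using AB(1,2) by (simp_all add: closedin_def topspace_toric_topology)
    obtain p where p: "eval_mpoly p x \<noteq> 0"
      "\<And>z. z \<notin> ?Z \<Longrightarrow> eval_mpoly p z \<noteq> 0 \<Longrightarrow> torus_orbit u z \<in> toric_variety \<Delta> u - A"
      using toric_open_preimage_basic[OF op(1) x(1)] x orbit by blast
    obtain q where q: "eval_mpoly q y \<noteq> 0"
      "\<And>z. z \<notin> ?Z \<Longrightarrow> eval_mpoly q z \<noteq> 0 \<Longrightarrow> torus_orbit u z \<in> toric_variety \<Delta> u - B"
      using toric_open_preimage_basic[OF op(2) y(1)] y orbit by blast
    obtain z where z: "eval_mpoly p z \<noteq> 0" "eval_mpoly q z \<noteq> 0"
      by (rule zariski_basic_opens_meet[OF p(1) q(1)])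
    then have "eval_mpoly (p * q) z \<noteq> 0" by simp
    then obtain z' where "eval_mpoly (p * q) z' \<noteq> 0" "eval_mpoly (\<Prod>i\<in>UNIV. var i) z' \<noteq> 0"
      using one by (rule zariski_basic_opens_meet)
    then have "z' \<notin> ?Z" "torus_orbit u z' \<in> toric_variety \<Delta> u - A" "torus_orbit u z' \<in> toric_variety \<Delta> u - B"
      using off_Z p(2) q(2) by simp_all
    then show False using AB(3) by blast
  qed
  moreover have "toric_variety \<Delta> u \<noteq> {}"
    using off_Z[OF one] by (auto simp: toric_variety_def)
  moreover have "closedin ?T (toric_variety \<Delta> u)"
    by (metis closedin_topspace topspace_toric_topology)
  ultimately show ?thesis by (auto simp: irreducible_closed_def)
qed

text \<open>No irreducible closed set strictly contains the whole space, so the only chain has length \<open>0\<close>.\<close>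

lemma codimension_topspace:
  assumes "irreducible_closed T (topspace T)"
  shows "codimension T (topspace T) = 0"
proof -
  let ?L = "{l. \<exists>C :: nat \<Rightarrow> 'a set. C 0 = topspace T \<and>
                 (\<forall>i\<le>l. irreducible_closed T (C i)) \<and> (\<forall>i<l. C i \<subset> C (Suc i))}"
  have "l = 0" if "l \<in> ?L" for l
  proof (rule ccontr)
    assume "l \<noteq> 0"
    from that obtain C :: "nat \<Rightarrow> 'a set" where C: "C 0 = topspace T"
        "\<forall>i\<le>l. irreducible_closed T (C i)" "\<forall>i<l. C i \<subset> C (Suc i)" by blast
    with \<open>l \<noteq> 0\<close> have "irreducible_closed T (C 1)" "C 0 \<subset> C 1" by auto
    then show False using closedin_subset[of T "C 1"] C(1) by (auto simp: irreducible_closed_def)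
  qed
  then have "(SUP l\<in>?L. enat l) \<le> 0"
    by (intro SUP_least) (simp add: zero_enat_def)
  then have "codimension T (topspace T) \<le> 0"
    unfolding codimension_def using assms
    by (intro INF_lower2[of "topspace T"]) auto
  then show ?thesis by simp
qed

section \<open>Degrees of divisor classes\<close>

lemma additive_vec_scale:
  fixes m :: "int ^ 'v \<Rightarrow> int"
  assumes "Modules.additive m"
  shows "m (c *s x) = c * m x"
proof -
  interpret Modules.additive m by fact
  have nat: "m (int n *s x) = int n * m x" for n
    by (induction n) (simp_all add: zero add vector_sadd_rdistrib distrib_right)
  show ?thesis
  proof (cases "c \<ge> 0")
    case True
    then show ?thesis using nat[of "nat c"] by simp
  next
    case False
    have "c *s x = - ((- c) *s x)" by (simp add: vec_eq_iff)
    from arg_cong[OF this, of m] have "m (c *s x) = - m ((- c) *s x)" by (simp only: minus)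
    moreover have "m ((- c) *s x) = (- c) * m x" using nat[of "nat (- c)"] False by (simp del: vector_smult_lneg)
    ultimately show ?thesis by (simp only: mult_minus_left minus_minus)
  qed
qed

lemma additive_vec_eq_sum:
  fixes m :: "int ^ 'v::finite \<Rightarrow> int"
  assumes "Modules.additive m"
  shows "m x = (\<Sum>i\<in>UNIV. m (axis i 1) * x $ i)"
proof -
  interpret Modules.additive m by fact
  have "x = (\<Sum>i\<in>UNIV. x $ i *s axis i 1)" by (rule basis_expansion[symmetric])
  then have "m x = (\<Sum>i\<in>UNIV. m (x $ i *s axis i 1))" by (metis sum)
  then show ?thesis by (simp add: additive_vec_scale[OF assms] mult.commute)
qed

lemma comm_group_additive_group: "comm_group (additive_group :: 'a::ab_group_add monoid)"
proof (rule comm_groupI)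
  fix x :: 'a
  show "\<exists>y\<in>carrier additive_group. y \<otimes>\<^bsub>additive_group\<^esub> x = \<one>\<^bsub>additive_group\<^esub>"
    by (intro bexI[of _ "- x"]) (simp_all add: additive_group_def)
qed (simp_all add: additive_group_def add_ac)

lemma principal_divisorsI: "Modules.additive m \<Longrightarrow> d = (\<chi> i. m (u i)) \<Longrightarrow> d \<in> principal_divisors u"
  unfolding principal_divisors_def by blast

lemma zero_in_principal_divisors: "0 \<in> principal_divisors u"
  by (rule principal_divisorsI[of "\<lambda>_. 0"]) (simp_all add: Modules.additive_def vec_eq_iff)

lemma principal_divisors_normal:
  "principal_divisors u \<lhd> (additive_group :: (int ^ 'v::finite) monoid)"
proof (rule comm_group.subgroup_imp_normal[OF comm_group_additive_group])
  interpret comm_group "additive_group :: (int ^ 'v) monoid" by (rule comm_group_additive_group)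
  have inv: "inv\<^bsub>additive_group\<^esub> d = - d" for d :: "int ^ 'v"
    by (rule inv_equality) (simp_all add: additive_group_def)
  show "subgroup (principal_divisors u) (additive_group :: (int ^ 'v) monoid)"
  proof (rule subgroupI)
    show "principal_divisors u \<noteq> {}" using zero_in_principal_divisors by blast
    fix d e assume "d \<in> principal_divisors u" and "e \<in> principal_divisors u"
    then obtain m n where m: "d = (\<chi> i. m (u i))" "Modules.additive m"
      and n: "e = (\<chi> i. n (u i))" "Modules.additive n"
      by (auto simp: principal_divisors_def)
    have "- d \<in> principal_divisors u"
      using m by (intro principal_divisorsI[of "\<lambda>x. - m x"]) (simp_all add: vec_eq_iff Modules.additive_def)
    then show "inv\<^bsub>additive_group\<^esub> d \<in> principal_divisors u" by (simp only: inv)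
    have "d + e \<in> principal_divisors u"
      using m n by (intro principal_divisorsI[of "\<lambda>x. m x + n x"]) (simp_all add: vec_eq_iff Modules.additive_def)
    then show "d \<otimes>\<^bsub>additive_group\<^esub> e \<in> principal_divisors u" by (simp add: additive_group_def)
  qed (simp add: additive_group_def)
qed

lemma carrier_class_group: "carrier (class_group u) = range (divisor_class u)"
  by (auto simp: class_group_def FactGroup_def RCOSETS_def divisor_class_def additive_group_def)

lemma divisor_class_add:
  "divisor_class u (d + e) = divisor_class u d \<otimes>\<^bsub>class_group u\<^esub> divisor_class u e"
  using normal.rcos_sum[OF principal_divisors_normal, of d e u]
  by (simp add: class_group_def divisor_class_def additive_group_def)

lemma divisor_class_eqE:
  assumes "divisor_class u d = divisor_class u e"
  obtains p where "p \<in> principal_divisors u" "d = p + e"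
proof -
  have "d = 0 \<otimes>\<^bsub>additive_group\<^esub> d" by (simp add: additive_group_def)
  then have "d \<in> divisor_class u d"
    unfolding divisor_class_def r_coset_def using zero_in_principal_divisors by blast
  then have "d \<in> divisor_class u e" by (simp only: assms)
  then show ?thesis using that by (auto simp: divisor_class_def r_coset_def additive_group_def)
qed

lemma degree_coord_mult:
  assumes "\<phi> \<in> iso (class_group u) (additive_group \<times>\<times> T)"
    and "\<alpha> \<in> carrier (class_group u)" "\<beta> \<in> carrier (class_group u)"
  shows "degree_coord \<phi> (\<alpha> \<otimes>\<^bsub>class_group u\<^esub> \<beta>) k = degree_coord \<phi> \<alpha> k + degree_coord \<phi> \<beta> k"
proof -
  have "\<phi> (\<alpha> \<otimes>\<^bsub>class_group u\<^esub> \<beta>) = \<phi> \<alpha> \<otimes>\<^bsub>additive_group \<times>\<times> T\<^esub> \<phi> \<beta>"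
    using assms(1) by (intro hom_mult[OF _ assms(2,3)]) (simp add: iso_def)
  then show ?thesis
    by (simp add: degree_coord_def mult_DirProd' additive_group_def)
qed

lemma degree_coord_additive:
  assumes "\<phi> \<in> iso (class_group u) (additive_group \<times>\<times> T)"
  shows "Modules.additive (\<lambda>d. degree_coord \<phi> (divisor_class u d) k)"
proof (rule Modules.additive.intro)
  have "divisor_class u d \<in> carrier (class_group u)" for d by (simp add: carrier_class_group)
  then show "degree_coord \<phi> (divisor_class u (d + e)) k
      = degree_coord \<phi> (divisor_class u d) k + degree_coord \<phi> (divisor_class u e) k" for d e
    by (simp only: divisor_class_add degree_coord_mult[OF assms])
qed

lemma degree_coord_divisor_class:
  assumes "\<phi> \<in> iso (class_group u) (additive_group \<times>\<times> T)"
  shows "degree_coord \<phi> (divisor_class u d) k = (\<Sum>i\<in>UNIV. degree_coord \<phi> (var_degree u i) k * d $ i)"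
  unfolding var_degree_def by (rule additive_vec_eq_sum[OF degree_coord_additive[OF assms]])

text \<open>A relation \<open>c\<close> among the \<open>u\<^sub>j\<close> defines the functional \<open>d \<mapsto> \<Sum> c\<^sub>j d\<^sub>j\<close>, which vanishes on principal divisors and so
  is a homomorphism from the class group to the integers. It kills torsion; hence it is an integer
  combination of the \<open>r\<close> free coordinates, and evaluating it on the classes \<open>[D\<^sub>j]\<close> gives the claim.\<close>

lemma relation_in_span_of_degrees:
  fixes u :: "'v::finite \<Rightarrow> int ^ 'n" and \<phi> :: "(int ^ 'v) set \<Rightarrow> (int ^ 'r) \<times> 't"
  assumes iso: "\<phi> \<in> iso (class_group u) (additive_group \<times>\<times> T)"
    and T: "finite (carrier T)" and one: "\<one>\<^bsub>T\<^esub> \<in> carrier T"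
    and relation: "(\<Sum>j\<in>UNIV. c $ j *s u j) = 0"
  obtains b where "\<And>j. c $ j = (\<Sum>k\<in>UNIV. b k * degree_coord \<phi> (var_degree u j) k)"
proof -
  define L where "L d = (\<Sum>j\<in>UNIV. c $ j * d $ j)" for d
  define D where "D k d = degree_coord \<phi> (divisor_class u d) k" for k d
  have L: "Modules.additive L"
    by (simp add: Modules.additive_def L_def distrib_left sum.distrib)
  interpret L: Modules.additive L by (rule L)
  have D: "Modules.additive (D k)" for k
    unfolding D_def by (rule degree_coord_additive[OF iso])
  have class_carrier: "divisor_class u d \<in> carrier (class_group u)" for d
    by (simp add: carrier_class_group)
  have bij: "bij_betw \<phi> (carrier (class_group u)) (UNIV \<times> carrier T)"
    using iso by (simp add: iso_def additive_group_def)
  have L_principal: "L d = 0" if d: "d \<in> principal_divisors u" for d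
  proof -
    obtain m where m: "d = (\<chi> i. m (u i))" "Modules.additive m"
      using d by (auto simp: principal_divisors_def)
    interpret m: Modules.additive m by (rule m(2))
    have "L d = (\<Sum>j\<in>UNIV. m (c $ j *s u j))"
      by (simp add: L_def m(1) additive_vec_scale[OF m(2)])
    also have "\<dots> = m (\<Sum>j\<in>UNIV. c $ j *s u j)" by (simp add: m.sum)
    finally show ?thesis by (simp add: relation m.zero)
  qed
  \<comment> \<open>Classes without free part are torsion: two different multiples of such a divisor have the same image under \<open>\<phi>\<close>.\<close>
  have L_degree_zero: "L d = 0" if d: "\<And>k. D k d = 0" for d
  proof -
    have "\<phi> (divisor_class u (int n *s d)) \<in> {0} \<times> carrier T" for n
    proof -
      have "fst (\<phi> (divisor_class u (int n *s d))) = 0"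
        using d additive_vec_scale[OF D] by (simp add: vec_eq_iff D_def degree_coord_def)
      then show ?thesis
        using bij_betw_apply[OF bij class_carrier[of "int n *s d"]] by (auto simp: mem_Times_iff)
    qed
    then have "range (\<lambda>n. \<phi> (divisor_class u (int n *s d))) \<subseteq> {0} \<times> carrier T" by blast
    then have "finite (range (\<lambda>n. \<phi> (divisor_class u (int n *s d))))"
      by (rule finite_subset) (simp add: T)
    then have "\<not> inj (\<lambda>n. \<phi> (divisor_class u (int n *s d)))"
      using finite_imageD infinite_UNIV_nat by blast
    then obtain m n where "m \<noteq> n"
      and eq: "\<phi> (divisor_class u (int m *s d)) = \<phi> (divisor_class u (int n *s d))"
      by (auto simp: inj_def)
    have "divisor_class u (int m *s d) = divisor_class u (int n *s d)"
      using bij_betw_imp_inj_on[OF bij] eq class_carrier class_carrier by (rule inj_onD)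
    then obtain p where "p \<in> principal_divisors u" "int m *s d = p + int n *s d"
      by (rule divisor_class_eqE)
    then have "L (int m *s d) = L (int n *s d)"
      by (simp only: L.add L_principal add_0)
    then have "int m * L d = int n * L d" by (simp only: additive_vec_scale[OF L])
    then show ?thesis using \<open>m \<noteq> n\<close> by simp
  qed
  have "\<exists>e. \<phi> (divisor_class u e) = (axis k 1, \<one>\<^bsub>T\<^esub>)" for k
  proof -
    have "(axis k 1, \<one>\<^bsub>T\<^esub>) \<in> \<phi> ` carrier (class_group u)"
      using bij one by (simp add: bij_betw_def)
    then show ?thesis unfolding carrier_class_group by (elim imageE) (metis rangeE)
  qed
  \<comment> \<open>Divisors whose classes are the basis vectors of the free part.\<close>
  then obtain e where e: "\<And>k. \<phi> (divisor_class u (e k)) = (axis k 1, \<one>\<^bsub>T\<^esub>)" by metis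
  have De: "D k (e l) = (if l = k then 1 else 0)" for k l
    by (simp add: D_def degree_coord_def e axis_def)
  have "c $ j = (\<Sum>k\<in>UNIV. L (e k) * degree_coord \<phi> (var_degree u j) k)" for j
  proof -
    define d where "d = axis j 1 - (\<Sum>l\<in>UNIV. D l (axis j 1) *s e l)"
    have "D k d = 0" for k
    proof -
      interpret D: Modules.additive "D k" by (rule D)
      show ?thesis
        by (simp add: d_def D.diff D.sum additive_vec_scale[OF D] De if_distrib cong: if_cong)
    qed
    then have "L d = 0" by (rule L_degree_zero)
    moreover have "L d = L (axis j 1) - (\<Sum>l\<in>UNIV. D l (axis j 1) * L (e l))"
      by (simp add: d_def L.diff L.sum additive_vec_scale[OF L])
    moreover have "L (axis j 1) = c $ j"
      by (simp add: L_def axis_def if_distrib cong: if_cong)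
    ultimately show ?thesis by (simp add: D_def var_degree_def mult.commute)
  qed
  then show ?thesis by (rule that)
qed

text \<open>Factor the minor through the \<open>r\<close> spanning vectors, padded with a zero row at the index \<open>None\<close>.\<close>

lemma wedge_eq_zero_if_spanned_by_fewer:
  fixes y :: "'r::finite \<Rightarrow> complex ^ 'v"
  assumes "\<And>s. w s = (\<Sum>k\<in>UNIV. M s k *s y k)"
  shows "wedge (w :: 'r option \<Rightarrow> _) = (\<lambda>J. 0)"
proof
  fix J
  define A :: "complex ^ 'r option ^ 'r option"
    where "A = (\<chi> s l. case l of None \<Rightarrow> 0 | Some k \<Rightarrow> M s k)"
  define B :: "complex ^ 'r option ^ 'r option"
    where "B = (\<chi> l t. case l of None \<Rightarrow> 0 | Some k \<Rightarrow> y k $ J t)"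
  have "(\<chi> s t. w s $ J t) = A ** B"
    by (simp add: vec_eq_iff matrix_matrix_mult_def assms A_def B_def UNIV_option_conv sum.reindex)
  moreover have "det B = 0"
    by (rule det_zero_row(1)[of None]) (simp add: row_def B_def vec_eq_iff)
  ultimately show "wedge w J = 0" by (simp add: wedge_def det_mul)
qed

section \<open>The degree bound\<close>

text \<open>At every point, the radial fields and \<open>X\<close> are combinations of the \<open>r\<close> fields
  \<open>\<Sum>\<^sub>j W\<^sub>k\<^sub>j z\<^sub>j \<partial>/\<partial>z\<^sub>j\<close>.\<close>

lemma radial_degeneracy_locus_eq_UNIV:
  fixes a :: "'r::finite \<Rightarrow> int ^ 'v::finite" and W :: "'r \<Rightarrow> 'v \<Rightarrow> int"
  assumes a: "\<And>i j. a i $ j = (\<Sum>k\<in>UNIV. b i k * W k j)"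
    and X: "\<And>x j. eval_mpoly (X $ j) x = (\<Sum>k\<in>UNIV. c x k * of_int (W k j)) * x $ j"
  shows "radial_degeneracy_locus a X = UNIV"
proof -
  have "wedge (\<lambda>s. eval_vfield (case s of None \<Rightarrow> X | Some i \<Rightarrow> radial_vfield a i) x) = (\<lambda>J. 0)" for x
  proof (rule wedge_eq_zero_if_spanned_by_fewer)
    show "eval_vfield (case s of None \<Rightarrow> X | Some i \<Rightarrow> radial_vfield a i) x
        = (\<Sum>k\<in>UNIV. (case s of None \<Rightarrow> c x k | Some i \<Rightarrow> of_int (b i k)) *s (\<chi> j. of_int (W k j) * x $ j))" for s
      by (cases s) (simp_all add: vec_eq_iff eval_vfield_def radial_vfield_def X a sum_distrib_right mult.assoc)
  qed
  then show ?thesis by (auto simp: radial_degeneracy_locus_def)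
qed

lemma weights_in_graded_piece:
  assumes "\<phi> \<in> iso (class_group u) (additive_group \<times>\<times> T)" and "P \<in> graded_piece u \<beta>"
  shows "weights_in (\<lambda>i. degree_coord \<phi> (var_degree u i) k) {degree_coord \<phi> \<beta> k} P"
  using assms(2) by (auto simp: weights_in_def graded_piece_def weight_def degree_coord_divisor_class[OF assms(1)])

lemma var_in_graded_piece: "var i \<in> graded_piece u (var_degree u i)"
proof -
  have "(\<chi> j. int (Poly_Mapping.lookup (Poly_Mapping.single i 1) j)) = axis i 1"
    by (simp add: vec_eq_iff lookup_single when_def axis_def)
  then show ?thesis by (simp add: graded_piece_def var_def var_degree_def)
qed

theorem theorem1p1:
  fixes \<Delta> :: "(real ^ 'n) set set"
    and u :: "'v::{finite,linorder} \<Rightarrow> int ^ 'n"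
    and T :: "'t monoid"
    and \<phi> :: "(int, 'v) vec set \<Rightarrow> (int ^ 'r) \<times> 't"
    and a :: "'r \<Rightarrow> (int, 'v) vec"
    and \<alpha> \<delta> :: "(int, 'v) vec set"
    and \<F> :: "'v vfield set"
    and X :: "'v vfield"
    and f :: "'v mpoly"
    and k :: 'r
  assumes "complete_fan \<Delta>" and "simplicial_fan \<Delta>"
    and "enumerates_primitive_generators \<Delta> u"
    and "CARD('v) = CARD('n) + CARD('r)"
    and "comm_group T" and "finite (carrier T)"
    and "\<phi> \<in> iso (class_group u) (additive_group \<times>\<times> T)"
    and "independent_relations u a"
    and "foliation \<Delta> u a \<alpha> \<F>" and "X \<in> \<F>"
    and "f \<in> graded_piece u \<delta>" and "\<not> constant_mpoly f"
    and "strongly_quasi_smooth f"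
    and "invariant_hypersurface u X f"
    and "\<And>P \<beta>. P \<noteq> 0 \<Longrightarrow> P \<in> graded_piece u \<beta> \<Longrightarrow> degree_coord \<phi> \<beta> k \<ge> 0"
  shows "degree_coord \<phi> \<delta> k \<le> degree_coord \<phi> \<alpha> k +
           Max {degree_coord \<phi> (var_degree u i) k + degree_coord \<phi> (var_degree u j) k | i j. i < j}"
proof (rule ccontr)
  define W where "W l j = degree_coord \<phi> (var_degree u j) l" for l j
  define w where "w = W k"
  let ?d = "degree_coord \<phi> \<delta> k" and ?e = "degree_coord \<phi> \<alpha> k"
  let ?S = "{w i + w j | i j. i < j}"
  note iso = assms(7)
  assume "\<not> ?thesis"
  then have less: "?e + Max ?S < ?d" by (simp add: w_def W_def)
  have fin: "finite ?S"
    by (rule finite_subset[of _ "(\<lambda>(i, j). w i + w j) ` UNIV"]) auto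
  have large: "?e + w i + w j < ?d" if "i \<noteq> j" for i j
  proof -
    have "\<exists>i' j'. w i + w j = w i' + w j' \<and> i' < j'"
      using that by (metis add.commute neq_iff)
    then have "w i + w j \<in> ?S" by blast
    then have "w i + w j \<le> Max ?S" by (rule Max_ge[OF fin])
    then show ?thesis using less by linarith
  qed
  have w_nonneg: "w i \<ge> 0" for i
  proof -
    have "var i \<noteq> 0" by (simp add: var_def flip: keys_eq_empty)
    from assms(15)[OF this var_in_graded_piece] show ?thesis by (simp add: w_def W_def)
  qed
  obtain X0 where \<alpha>: "\<alpha> \<in> carrier (class_group u)"
    and codim: "codimension (toric_topology \<Delta> u) (singular_set \<Delta> u a X0) \<ge> 2"
    and \<F>: "\<F> = {Y. quasi_homogeneous_vfield u \<alpha> Y \<and>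
                 (\<exists>g :: 'r \<Rightarrow> 'v mpoly. Y = X0 + (\<Sum>i\<in>UNIV. g i *s radial_vfield a i))}"
    using assms(9) by (auto simp: foliation_def)
  obtain g :: "'r \<Rightarrow> 'v mpoly" where g: "X = X0 + (\<Sum>i\<in>UNIV. g i *s radial_vfield a i)"
    and X: "\<And>i. X $ i \<in> graded_piece u (\<alpha> \<otimes>\<^bsub>class_group u\<^esub> var_degree u i)"
    using assms(10) by (auto simp: \<F> quasi_homogeneous_vfield_def)
  have X_degree: "degree_coord \<phi> (\<alpha> \<otimes>\<^bsub>class_group u\<^esub> var_degree u i) k = ?e + w i" for i
    by (subst degree_coord_mult[OF iso \<alpha>]) (simp_all add: w_def W_def var_degree_def carrier_class_group)
  have X_weights: "weights_in w {?e + w i} (X $ i)" for i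
    using weights_in_graded_piece[OF iso X, where k = k] by (simp add: X_degree w_def W_def[abs_def])
  have f_weights: "weights_in w {?d} f"
    using weights_in_graded_piece[OF iso assms(11), where k = k] by (simp add: w_def W_def[abs_def])
  \<comment> \<open>The field \<open>X\<close> is proportional to the radial field of the weights at every point.\<close>
  have "\<exists>\<kappa>. \<forall>x j. eval_mpoly (X $ j) x = \<kappa> x * of_int (w j) * x $ j"
  proof (cases "X = 0")
    case True
    then show ?thesis by (intro exI[of _ "\<lambda>_. 0"]) simp
  next
    case False
    then obtain i where "X $ i \<noteq> 0" by (auto simp: vec_eq_iff)
    then have nonneg: "?e + w i \<ge> 0" using assms(15)[OF _ X] by (simp add: X_degree)
    have "CARD('n) > 0" "CARD('r) > 0" by simp_all
    then have "CARD('v) > 1" using assms(4) by linarith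
    moreover have "card {i} = 1" by simp
    ultimately obtain j where "i \<noteq> j" by (metis UNIV_eq_I insertCI less_irrefl)
    \<comment> \<open>A nonzero coefficient has nonnegative weight, which makes \<open>d\<close> positive and the Euler identity usable.\<close>
    from large[OF this] have d: "?d \<noteq> 0" using nonneg w_nonneg[of j] by linarith
    obtain G where "apply_vfield X f = G * f"
      using assms(14) by (auto simp: invariant_hypersurface_def)
    then obtain h where h: "\<And>j. of_int ?d * X $ j = of_int (w j) * var j * h"
      using invariant_field_proportional_to_radial[OF w_nonneg f_weights X_weights d large assms(13)] by metis
    have "eval_mpoly (X $ j) x = eval_mpoly h x / of_int ?d * of_int (w j) * x $ j" for x j
    proof -
      have "eval_mpoly (of_int ?d * X $ j) x = eval_mpoly (of_int (w j) * var j * h) x" by (simp only: h)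
      then show ?thesis using d by (simp add: field_simps)
    qed
    then show ?thesis by (intro exI[of _ "\<lambda>x. eval_mpoly h x / of_int ?d"]) blast
  qed
  then obtain \<kappa> where \<kappa>: "\<And>x j. eval_mpoly (X $ j) x = \<kappa> x * of_int (w j) * x $ j" by blast
  have one: "\<one>\<^bsub>T\<^esub> \<in> carrier T"
    using assms(5) by (simp add: comm_groupE(2))
  have "\<exists>b. \<forall>j. a i $ j = (\<Sum>l\<in>UNIV. b l * W l j)" for i
    unfolding W_def
    by (rule relation_in_span_of_degrees[OF iso assms(6) one, of "a i"])
       (use assms(8) in \<open>auto simp: independent_relations_def\<close>)
  then obtain b where b: "\<And>i j. a i $ j = (\<Sum>l\<in>UNIV. b i l * W l j)" by metis
  have "radial_degeneracy_locus a X0 = UNIV"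
  proof (rule radial_degeneracy_locus_eq_UNIV[OF b])
    fix x j
    have "eval_mpoly (X $ j) x = eval_mpoly (X0 $ j) x + (\<Sum>i\<in>UNIV. eval_mpoly (g i) x * of_int (a i $ j) * x $ j)"
      by (simp add: g radial_vfield_def mult.assoc)
    also have "(\<Sum>i\<in>UNIV. eval_mpoly (g i) x * of_int (a i $ j) * x $ j)
        = (\<Sum>i\<in>UNIV. \<Sum>l\<in>UNIV. eval_mpoly (g i) x * of_int (b i l) * of_int (W l j) * x $ j)"
      by (simp add: b sum_distrib_left sum_distrib_right mult.assoc)
    also have "\<dots> = (\<Sum>l\<in>UNIV. \<Sum>i\<in>UNIV. eval_mpoly (g i) x * of_int (b i l) * of_int (W l j) * x $ j)"
      by (rule sum.swap)
    finally have "eval_mpoly (X0 $ j) x = \<kappa> x * of_int (w j) * x $ j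
        - (\<Sum>l\<in>UNIV. \<Sum>i\<in>UNIV. eval_mpoly (g i) x * of_int (b i l) * of_int (W l j) * x $ j)"
      by (simp add: \<kappa>)
    \<comment> \<open>The weights are the \<open>k\<close>-th row of \<open>W\<close>.\<close>
    also have "\<kappa> x * of_int (w j) * x $ j = (\<Sum>l\<in>UNIV. (if l = k then \<kappa> x else 0) * of_int (W l j) * x $ j)"
      by (simp add: w_def if_distrib[of "\<lambda>c. c * _"] cong: if_cong)
    finally show "eval_mpoly (X0 $ j) x
        = (\<Sum>l\<in>UNIV. ((if l = k then \<kappa> x else 0) - (\<Sum>i\<in>UNIV. eval_mpoly (g i) x * of_int (b i l))) * of_int (W l j)) * x $ j"
      by (simp only: left_diff_distrib sum_subtractf sum_distrib_right)
  qed
  then have "singular_set \<Delta> u a X0 = topspace (toric_topology \<Delta> u)"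
    unfolding topspace_toric_topology by (auto simp: singular_set_def toric_variety_def)
  moreover have "\<Delta> \<noteq> {}" using assms(1) by (auto simp: complete_fan_def fan_def)
  ultimately have "codimension (toric_topology \<Delta> u) (singular_set \<Delta> u a X0) = 0"
    using codimension_topspace[of "toric_topology \<Delta> u"] toric_variety_irreducible[of \<Delta> u]
    by (simp add: topspace_toric_topology)
  then show False using codim by simp
qed

end
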